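(* Let $\eta^{12}(2z) = \sum_{n=1}^\infty \gamma(n)q^n$ be the unique newform in $S_6(\Gamma_0(4))$. Then for every odd prime $p$, $$\gamma(p) \equiv \sum_{\substack{k_1,k_2,k_3,k_4=0\\ k_1+k_2=k_3+k_4}}^{\frac{p-1}{2}}\ \prod_{i=1}^4\binom{\frac{p-1}{2}}{k_i}\binom{\frac{p-1}{2}+k_i}{k_i} \pmod{p^2}.$$
   Context: $\eta(z) = q^{1/24}\prod_{n\ge1}(1-q^n)$ is the Dedekind eta function, $q = e^{2\pi i z}$. The sum runs over integers $0 \le k_i \le \frac{p-1}{2}$ with $k_1+k_2 = k_3+k_4$. *)

theory Defs
  imports "HOL-Computational_Algebra.Polynomial" "HOL-Number_Theory.Cong"
begin

text \<open>eta(2z)^12 = q^{(12*2)/24} prod_{m>=1} (1 - q^{2m})^12 = q * prod_{m>=1} (1 - q^{2m})^12.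
  Hence the coefficient gamma(n) of q^n (n >= 1) is the coefficient of X^(n-1) in
  prod_{m>=1} (1 - X^{2m})^12; factors with m > n do not affect this coefficient,
  so the finite product over m = 1..n gives the exact value.\<close>

definition eta12_coeff :: "nat \<Rightarrow> int" where
  "eta12_coeff n = (if n = 0 then 0
     else coeff (\<Prod>m\<in>{1..n}. (1 - monom (1::int) (2*m)) ^ 12) (n - 1))"

definition binom_term :: "nat \<Rightarrow> nat \<Rightarrow> int" where
  "binom_term h k = int ((h choose k) * ((h + k) choose k))"

end

theory Submission
  imports Defs "HOL-Computational_Algebra.Formal_Power_Series"
begin

text \<open>
  Let \<open>t = (\<theta>\<^sub>3\<^sup>4 - \<theta>\<^sub>4\<^sup>4) / (16 \<theta>\<^sub>3\<^sup>4)\<close>, a power series in \<open>q\<close>, and let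
  \<open>F(x) = \<Sum> binom(2k, k)\<^sup>2 x\<^sup>k\<close>. Jacobi's relations \<open>F(t) = \<theta>\<^sub>3\<^sup>2\<close> and
  \<open>q dt/dq = t (1 - 16t) \<theta>\<^sub>3\<^sup>4\<close> turn \<open>\<eta>(2z)\<^sup>1\<^sup>2 dq/q\<close> into \<open>F(t)\<^sup>4 dt\<close>. They are
  obtained from the doubling formulas \<open>q \<mapsto> q\<^sup>2\<close> of the theta series, since a power series
  invariant under \<open>q \<mapsto> q\<^sup>2\<close> is constant. So \<open>\<gamma>(p)\<close> is the residue of \<open>F(t)\<^sup>4 q\<^sup>-\<^sup>p dt\<close>.

  Up to its leading coefficient, the Frobenius deformation \<open>Y(t)\<close> of \<open>F\<close> with exponent \<open>-p/2\<close>
  is a polynomial that is congruent to \<open>F(t) (t/q)\<^sup>p\<^sup>/\<^sup>2\<close> modulo \<open>p\<^sup>2\<close> and \<open>t\<^sup>p\<close>, by the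
  hypergeometric differential equation. Hence \<open>\<gamma>(p)\<close> is congruent to the coefficient of
  \<open>t\<^sup>p\<^sup>-\<^sup>1\<close> in \<open>F\<^sup>2 Y\<^sup>2\<close>. The coefficients of \<open>Y\<close> are, up to powers of \<open>256\<close>, those of \<open>F\<close> in
  reversed order below degree \<open>p/2\<close>; this reversal changes the condition
  \<open>k\<^sub>1 + k\<^sub>2 + k\<^sub>3 + k\<^sub>4 = p - 1\<close> into \<open>k\<^sub>1 + k\<^sub>2 = k\<^sub>3 + k\<^sub>4\<close>.
\<close>

unbundle fps_syntax

section \<open>Theta series and the substitution of the square of the variable\<close>

definition dilate :: "rat fps \<Rightarrow> rat fps" where
  "dilate f = f oo fps_X ^ 2"

lemma dilate_nth: "dilate f $ n = (if even n then f $ (n div 2) else 0)"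
proof -
  have "dilate f $ n = (\<Sum>i=0..n. if n = 2 * i then f $ i else 0)"
    by (auto simp: dilate_def fps_compose_nth fps_X_power_nth simp flip: power_mult intro!: sum.cong)
  also have "\<dots> = (if even n then f $ (n div 2) else 0)"
    by (auto elim!: evenE simp: sum.delta intro!: sum.neutral)
  finally show ?thesis .
qed

lemma dilate_simps [simp]:
  "dilate (f + g) = dilate f + dilate g"
  "dilate (f - g) = dilate f - dilate g"
  "dilate (f * g) = dilate f * dilate g"
  "dilate (f ^ n) = dilate f ^ n"
  "dilate (fps_const c) = fps_const c"
  "dilate (numeral k) = numeral k"
  "dilate 1 = 1"
  "dilate fps_X = fps_X ^ 2"
  by (simp_all add: dilate_def fps_compose_add_distrib fps_compose_sub_distrib
      fps_compose_mult_distrib fps_compose_power)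

lemma dilate_nth_0 [simp]: "dilate f $ 0 = f $ 0"
  by (simp add: dilate_nth)

lemma dilate_compose: "g $ 0 = 0 \<Longrightarrow> dilate (f oo g) = f oo dilate g"
  unfolding dilate_def by (rule fps_compose_assoc [symmetric]) auto

text \<open>Repeated halving of a positive index ends at an odd one, where the coefficient of
  \<open>dilate r\<close> is 0. Both of Jacobi's relations are proved by applying this to a
  quotient.\<close>

lemma dilate_fixed:
  assumes "dilate r = r"
  shows "r = fps_const (r $ 0)"
proof (rule fps_ext)
  fix n show "r $ n = fps_const (r $ 0) $ n"
  proof (induction n rule: less_induct)
    case (less n)
    show ?case
    proof (cases "n = 0")
      case False
      have "r $ n = (if even n then r $ (n div 2) else 0)"
        by (subst assms [symmetric]) (rule dilate_nth)
      with less [of "n div 2"] False show ?thesis by auto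
    qed auto
  qed
qed

text \<open>Once \<open>r $ i = 0\<close> for \<open>0 < i < n\<close>, the coefficient of
  \<open>r ^ 2\<close> at n is \<open>2 * r $ n\<close>, while that of \<open>dilate r\<close> is 0.
  This is the multiplicative companion of \<open>dilate_fixed\<close>.\<close>

lemma dilate_eq_square:
  assumes "dilate r = r ^ 2" and "r $ 0 = 1"
  shows "r = 1"
proof (rule fps_ext)
  fix n show "r $ n = 1 $ n"
  proof (induction n rule: less_induct)
    case (less n)
    show ?case
    proof (cases "n = 0")
      case False
      have "(r ^ 2) $ n = (\<Sum>i=0..n. r $ i * r $ (n - i))"
        by (simp add: power2_eq_square fps_mult_nth)
      also have "\<dots> = (\<Sum>i\<in>{0, n}. r $ i * r $ (n - i))"
        using less by (intro sum.mono_neutral_right) auto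
      also have "\<dots> = 2 * r $ n"
        using False assms(2) by simp
      finally have "2 * r $ n = (if even n then r $ (n div 2) else 0)"
        using assms(1) by (metis dilate_nth)
      moreover have "even n \<Longrightarrow> n div 2 \<noteq> 0" using False by (auto elim: evenE)
      ultimately show ?thesis using less [of "n div 2"] False by (cases "even n") auto
    qed (use assms in auto)
  qed
qed

section \<open>Theta series as generating functions of sums of squares\<close>

definition sq_reps :: "nat \<Rightarrow> int set" where
  "sq_reps n = {x. x ^ 2 = int n}"

definition two_sq_reps :: "nat \<Rightarrow> (int \<times> int) set" where
  "two_sq_reps n = {(x, y). x ^ 2 + y ^ 2 = int n}"

definition theta3 :: "rat fps" where
  "theta3 = Abs_fps (\<lambda>n. of_nat (card (sq_reps n)))"

text \<open>The sign at \<open>q^(k^2)\<close> should be \<open>(-1)^k\<close>; since k and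
  \<open>k^2\<close> have the same parity, it can be read off from the exponent.\<close>

definition theta4 :: "rat fps" where
  "theta4 = Abs_fps (\<lambda>n. (-1) ^ n * of_nat (card (sq_reps n)))"

lemma abs_le_square_int: "\<bar>x\<bar> \<le> (x::int) ^ 2"
proof (cases "x = 0")
  case False
  then have "\<bar>x\<bar> ^ 1 \<le> \<bar>x\<bar> ^ 2" by (intro power_increasing) auto
  then show ?thesis by simp
qed auto

lemma finite_sq_reps [simp]: "finite (sq_reps n)"
proof (rule finite_subset)
  show "sq_reps n \<subseteq> {- int n..int n}"
  proof
    fix x assume "x \<in> sq_reps n"
    then show "x \<in> {- int n..int n}"
      using abs_le_square_int [of x] by (auto simp: sq_reps_def)
  qed
qed auto

lemma two_sq_reps_eq:
  "two_sq_reps n = (\<Union>i\<in>{0..n}. sq_reps i \<times> sq_reps (n - i))"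
proof -
  have "\<exists>i\<in>{0..n}. x \<in> sq_reps i \<and> y \<in> sq_reps (n - i)" if "x ^ 2 + y ^ 2 = int n" for x y :: int
  proof -
    have "int n = int (nat (x ^ 2) + nat (y ^ 2))"
      using that by simp
    then have "n = nat (x ^ 2) + nat (y ^ 2)"
      by linarith
    then show ?thesis
      by (intro bexI [of _ "nat (x ^ 2)"]) (auto simp: sq_reps_def)
  qed
  then show ?thesis
    by (auto simp: two_sq_reps_def sq_reps_def of_nat_diff)
qed

lemma finite_two_sq_reps [simp]: "finite (two_sq_reps n)"
  by (simp add: two_sq_reps_eq)

text \<open>The weight depends on the first square only, so it is constant on each product set.
  Weight 1 yields \<open>theta3 ^ 2\<close>, an alternating weight yields
  \<open>theta4 * theta3\<close>.\<close>

lemma sum_two_sq_reps: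
  fixes g :: "nat \<Rightarrow> rat"
  shows "(\<Sum>(x, y)\<in>two_sq_reps n. g (nat (x ^ 2)))
    = (\<Sum>i=0..n. g i * of_nat (card (sq_reps i)) * of_nat (card (sq_reps (n - i))))"
proof -
  have "(\<Sum>(x, y)\<in>two_sq_reps n. g (nat (x ^ 2)))
      = (\<Sum>i=0..n. \<Sum>(x, y)\<in>sq_reps i \<times> sq_reps (n - i). g (nat (x ^ 2)))"
    unfolding two_sq_reps_eq by (rule sum.UNION_disjoint) (auto, auto simp: sq_reps_def)
  also have "\<dots> = (\<Sum>i=0..n. \<Sum>(x, y)\<in>sq_reps i \<times> sq_reps (n - i). g i)"
    by (intro sum.cong) (auto simp: sq_reps_def)
  also have "\<dots> = (\<Sum>i=0..n. g i * of_nat (card (sq_reps i)) * of_nat (card (sq_reps (n - i))))"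
    by (intro sum.cong) (auto simp: case_prod_unfold card_cartesian_product mult_ac)
  finally show ?thesis .
qed

lemma theta3_square_nth: "(theta3 ^ 2) $ n = of_nat (card (two_sq_reps n))"
  using sum_two_sq_reps [of "\<lambda>_. 1" n]
  by (simp add: power2_eq_square fps_mult_nth theta3_def case_prod_unfold)

lemma theta4_square_nth: "(theta4 ^ 2) $ n = (-1) ^ n * of_nat (card (two_sq_reps n))"
proof -
  have "(theta4 ^ 2) $ n = (\<Sum>i=0..n. (-1) ^ n * (of_nat (card (sq_reps i)) * of_nat (card (sq_reps (n - i)))))"
    unfolding power2_eq_square fps_mult_nth theta4_def fps_nth_Abs_fps
  proof (intro sum.cong refl)
    fix i assume "i \<in> {0..n}"
    then have "(-1 :: rat) ^ n = (-1) ^ i * (-1) ^ (n - i)"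
      by (simp flip: power_add)
    then show "(-1) ^ i * rat_of_nat (card (sq_reps i)) * ((-1) ^ (n - i) * rat_of_nat (card (sq_reps (n - i))))
      = (-1) ^ n * (of_nat (card (sq_reps i)) * of_nat (card (sq_reps (n - i))))"
      by simp
  qed
  also have "\<dots> = (-1) ^ n * (theta3 ^ 2) $ n"
    by (simp add: power2_eq_square fps_mult_nth theta3_def flip: sum_distrib_left)
  finally show ?thesis
    by (simp add: theta3_square_nth)
qed

lemma theta34_nth:
  "(theta4 * theta3) $ n = (\<Sum>(x, y)\<in>two_sq_reps n. (-1) ^ nat (x ^ 2))"
  by (simp add: sum_two_sq_reps fps_mult_nth theta3_def theta4_def)

text \<open>The source of both doubling formulas:
  \<open>(u + v)^2 + (u - v)^2 = 2 (u^2 + v^2)\<close>, and x, y have equal parity when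
  \<open>x^2 + y^2\<close> is even, so the halves are integers.\<close>

lemma bij_two_sq_reps:
  "bij_betw (\<lambda>(u, v). (u + v, u - v)) (two_sq_reps n) (two_sq_reps (2 * n))"
proof (rule bij_betw_byWitness [where f' = "\<lambda>(x, y). ((x + y) div 2, (x - y) div 2)"])
  show "(\<lambda>(x, y). ((x + y) div 2, (x - y) div 2)) ` two_sq_reps (2 * n) \<subseteq> two_sq_reps n"
  proof (clarsimp simp: two_sq_reps_def)
    fix x y :: int
    assume eq: "x ^ 2 + y ^ 2 = 2 * int n"
    then have "even (x ^ 2 + y ^ 2)" by simp
    then have e: "even (x + y)" "even (x - y)" by auto
    then obtain u v where "x + y = 2 * u" "x - y = 2 * v" by (elim evenE)
    moreover from this have "x = u + v" "y = u - v" by auto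
    ultimately show "((x + y) div 2) ^ 2 + ((x - y) div 2) ^ 2 = int n"
      using eq by simp (simp add: power2_eq_square algebra_simps)
  qed
  show "\<forall>p\<in>two_sq_reps (2 * n). (\<lambda>(u, v). (u + v, u - v)) ((\<lambda>(x, y). ((x + y) div 2, (x - y) div 2)) p) = p"
  proof (clarsimp simp: two_sq_reps_def)
    fix x y :: int
    assume eq: "x ^ 2 + y ^ 2 = 2 * int n"
    then have "even (x ^ 2 + y ^ 2)" by simp
    then have e: "even (x + y)" "even (x - y)" by auto
    then obtain u v where "x + y = 2 * u" "x - y = 2 * v" by (elim evenE)
    then show "(x + y) div 2 + (x - y) div 2 = x \<and> (x + y) div 2 - (x - y) div 2 = y"
      by auto
  qed
qed (auto simp: two_sq_reps_def power2_eq_square algebra_simps)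

text \<open>Odd coefficients cancel and even ones double; \<open>bij_two_sq_reps\<close> then
  matches the representations of 2m with those of m.\<close>

lemma theta_square_sum: "theta3 ^ 2 + theta4 ^ 2 = 2 * dilate (theta3 ^ 2)"
proof (rule fps_ext)
  fix n show "(theta3 ^ 2 + theta4 ^ 2) $ n = (2 * dilate (theta3 ^ 2)) $ n"
    using bij_betw_same_card [OF bij_two_sq_reps, of "n div 2"]
    by (auto simp: dilate_nth theta3_square_nth theta4_square_nth numeral_fps_const
        simp del: dilate_simps elim!: evenE)
qed

text \<open>With \<open>theta_square_sum\<close>, this makes q -> q^2 a step of the
  arithmetic-geometric mean on \<open>theta3 ^ 2\<close> and \<open>theta4 ^ 2\<close>. At even
  indices the bijection makes the sign constant; at odd ones swapping x and y negates the
  sum.\<close>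

lemma theta_prod: "theta4 * theta3 = dilate (theta4 ^ 2)"
proof (rule fps_ext)
  fix n show "(theta4 * theta3) $ n = dilate (theta4 ^ 2) $ n"
  proof (cases "even n")
    case True
    then obtain m where n: "n = 2 * m" by (elim evenE)
    have par: "even (nat ((u + v) ^ 2)) \<longleftrightarrow> even m" if "u ^ 2 + v ^ 2 = int m" for u v :: int
    proof -
      have "even (nat ((u + v) ^ 2)) \<longleftrightarrow> even (u ^ 2 + v ^ 2)"
        by (simp add: even_nat_iff)
      then show ?thesis unfolding that by simp
    qed
    have "(theta4 * theta3) $ n = (\<Sum>(u, v)\<in>two_sq_reps m. (-1) ^ nat ((u + v) ^ 2))"
      unfolding theta34_nth n
      by (subst sum.reindex_bij_betw [OF bij_two_sq_reps, symmetric]) (simp add: case_prod_unfold)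
    also have "\<dots> = (\<Sum>(u, v)\<in>two_sq_reps m. (-1) ^ m)"
      using par by (intro sum.cong) (auto simp: two_sq_reps_def minus_one_power_iff)
    finally show ?thesis
      by (simp add: n dilate_nth theta4_square_nth mult.commute case_prod_unfold del: dilate_simps)
  next
    case False
    have sw: "bij_betw prod.swap (two_sq_reps n) (two_sq_reps n)"
      by (rule bij_betw_byWitness [where f' = prod.swap]) (auto simp: two_sq_reps_def)
    have "(-1 :: rat) ^ nat (x ^ 2) = - ((-1) ^ nat (y ^ 2))" if "x ^ 2 + y ^ 2 = int n" for x y :: int
    proof -
      have "odd (x ^ 2 + y ^ 2)" using that False by simp
      then show ?thesis by (auto simp: minus_one_power_iff even_nat_iff)
    qed
    then have "(\<Sum>(x, y)\<in>two_sq_reps n. (-1 :: rat) ^ nat (x ^ 2))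
        = (\<Sum>(x, y)\<in>two_sq_reps n. - ((-1) ^ nat (y ^ 2)))"
      by (intro sum.cong) (auto simp: two_sq_reps_def)
    also have "\<dots> = - (\<Sum>(x, y)\<in>two_sq_reps n. (-1) ^ nat (x ^ 2))"
      by (subst (2) sum.reindex_bij_betw [OF sw, symmetric])
        (simp add: case_prod_unfold sum_negf)
    finally show ?thesis
      using False by (simp add: theta34_nth dilate_nth del: dilate_simps)
  qed
qed

section \<open>The identity of Gauss for the alternating theta series\<close>

lemma fps_X_power_dvd_iff: "fps_X ^ n dvd (f :: rat fps) \<longleftrightarrow> (\<forall>i<n. f $ i = 0)"
proof
  assume "\<forall>i<n. f $ i = 0"
  then have "f = fps_X ^ n * fps_shift n f"
    by (auto simp: fps_eq_iff fps_X_power_mult_nth)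
  then show "fps_X ^ n dvd f" by (rule dvdI)
qed (auto simp: fps_X_power_mult_nth elim!: dvdE)

lemma fps_eqI_mod_X_powers:
  assumes "\<And>n. fps_X ^ Suc n dvd f - (g :: rat fps)"
  shows "f = g"
  using assms by (auto simp: fps_eq_iff fps_X_power_dvd_iff simp del: power_Suc)

lemma dilate_X_power_dvd: "fps_X ^ n dvd f \<Longrightarrow> fps_X ^ n dvd dilate f"
  by (auto simp: fps_X_power_dvd_iff dilate_nth)

definition euler_poly :: "nat \<Rightarrow> rat fps" where
  "euler_poly n = (\<Prod>j=1..n. 1 - fps_X ^ j)"

text \<open>The infinite product of all \<open>1 - q^j\<close>: the coefficient at
  \<open>q^n\<close> no longer changes after n factors, so the diagonal gives the limit.\<close>

definition euler :: "rat fps" where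
  "euler = Abs_fps (\<lambda>n. euler_poly n $ n)"

lemma euler_poly_0 [simp]: "euler_poly 0 = 1"
  by (simp add: euler_poly_def)

lemma euler_poly_Suc: "euler_poly (Suc n) = euler_poly n * (1 - fps_X ^ Suc n)"
  by (simp add: euler_poly_def)

lemma euler_poly_nth_0 [simp]: "euler_poly n $ 0 = 1"
  by (induction n) (simp_all add: euler_poly_Suc)

lemma euler_poly_cong: "n \<le> N \<Longrightarrow> fps_X ^ Suc n dvd euler_poly N - euler_poly n"
proof (induction N rule: dec_induct)
  case (step N)
  have "euler_poly (Suc N) - euler_poly n
      = (euler_poly N - euler_poly n) - fps_X ^ Suc N * euler_poly N"
    by (simp add: euler_poly_Suc algebra_simps)
  moreover have "fps_X ^ Suc n dvd (fps_X ^ Suc N :: rat fps)"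
    using step by (intro le_imp_power_dvd) auto
  ultimately show ?case
    using step by (metis dvd_diff dvd_mult2)
qed auto

lemma euler_cong: "fps_X ^ Suc n dvd euler - euler_poly n"
proof -
  have "euler $ i = euler_poly n $ i" if "i \<le> n" for i
    using euler_poly_cong [OF that] by (auto simp: euler_def fps_X_power_dvd_iff simp del: power_Suc)
  then show ?thesis by (simp add: fps_X_power_dvd_iff del: power_Suc)
qed

lemma euler_nth_0 [simp]: "euler $ 0 = 1"
  by (simp add: euler_def)

text \<open>Extending the reciprocals by \<open>0\<close> to negative indices makes all boundary terms of the
  telescoping sum below vanish.\<close>

definition inv_euler_poly :: "int \<Rightarrow> rat fps" where
  "inv_euler_poly m = (if m < 0 then 0 else inverse (euler_poly (nat m)))"

lemma inv_euler_poly_pred: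
  assumes "m \<ge> 0"
  shows "inv_euler_poly (m - 1) = (1 - fps_X ^ nat m) * inv_euler_poly m"
proof (cases "m = 0")
  case False
  define n where "n = nat (m - 1)"
  have n: "nat m = Suc n" "nat (m - 1) = n" "m \<ge> 1" using False assms by (auto simp: n_def)
  have "(1 - fps_X ^ Suc n :: rat fps) $ 0 \<noteq> 0" by simp
  then have "(1 - fps_X ^ Suc n) * inverse (1 - fps_X ^ Suc n :: rat fps) = 1"
    by (rule inverse_mult_eq_1')
  moreover have "inv_euler_poly m = inverse (euler_poly n) * inverse (1 - fps_X ^ Suc n)"
    using n by (simp only: inv_euler_poly_def euler_poly_Suc fps_inverse_mult) simp
  moreover have "inv_euler_poly (m - 1) = inverse (euler_poly n)"
    using n by (simp add: inv_euler_poly_def)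
  ultimately show ?thesis unfolding n by (metis mult.left_commute mult.right_neutral)
qed (simp add: inv_euler_poly_def)

lemma inv_euler_poly_cong:
  assumes "m \<ge> int n"
  shows "fps_X ^ Suc n dvd euler * inv_euler_poly m - 1"
proof -
  have "inverse (euler_poly (nat m)) * euler_poly (nat m) = 1"
    by (rule inverse_mult_eq_1) simp
  then have "euler * inv_euler_poly m - 1 = inv_euler_poly m * (euler - euler_poly (nat m))"
    using assms by (simp add: inv_euler_poly_def algebra_simps)
  moreover have "fps_X ^ Suc n dvd (fps_X ^ Suc (nat m) :: rat fps)"
    using assms by (intro le_imp_power_dvd) auto
  ultimately show ?thesis
    using euler_cong [of "nat m"] by (metis dvd_mult dvd_trans)
qed

text \<open>A finite form of \<open>theta4 / euler ^ 2\<close>: as N grows, both reciprocals tend to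
  \<open>1 / euler\<close>.\<close>

definition gauss_sum :: "nat \<Rightarrow> rat fps" where
  "gauss_sum N = (\<Sum>k\<in>{- int N..int N}. (-1) ^ nat \<bar>k\<bar> * fps_X ^ nat (k ^ 2) *
     (inv_euler_poly (int N - k) * inv_euler_poly (int N + k)))"

lemma minus_one_power_nat_pred: "(-1) ^ nat \<bar>k - 1\<bar> = - ((-1) ^ nat \<bar>k\<bar> :: rat fps)"
  by (simp add: minus_one_power_iff even_nat_iff)

text \<open>Creative telescoping: the summands of the two sides differ by
  \<open>v k - v (k - 1)\<close> for an explicit \<open>v\<close>.\<close>

lemma gauss_sum_Suc: "(1 - fps_X ^ (2 * Suc N)) * gauss_sum (Suc N) = gauss_sum N"
proof -
  define M where "M = int (Suc N)"
  define \<sigma> where "\<sigma> = (\<lambda>k::int. (-1) ^ nat \<bar>k\<bar> :: rat fps)"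
  \<comment> \<open>The telescoping certificate. At \<open>k = M\<close> and at
    \<open>k = - M - 1\<close> an index of \<open>inv_euler_poly\<close> is -1, so \<open>v\<close>
    vanishes there.\<close>
  define v where "v = (\<lambda>k. \<sigma> k * fps_X ^ nat (k ^ 2 + k + M) *
     (inv_euler_poly (M - k - 1) * inv_euler_poly (M + k)))"
  define u where "u = (\<lambda>L k. \<sigma> k * fps_X ^ nat (k ^ 2) *
     (inv_euler_poly (L - k) * inv_euler_poly (L + k)))"
  have step: "(1 - fps_X ^ (2 * Suc N)) * u M k - u (M - 1) k = v k - v (k - 1)"
    if k: "k \<in> {-M..M}" for k
  proof -
    \<comment> \<open>In terms of these quantities the claim becomes a polynomial identity.\<close>
    define x1 where "x1 = (fps_X ^ nat (M - k) :: rat fps)"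
    define x2 where "x2 = (fps_X ^ nat (M + k) :: rat fps)"
    define y where "y = (fps_X ^ nat (k ^ 2) :: rat fps)"
    define P where "P = inv_euler_poly (M - k)"
    define Q where "Q = inv_euler_poly (M + k)"
    have x12: "fps_X ^ (2 * Suc N) = x1 * x2"
    proof -
      have "2 * Suc N = nat (M - k) + nat (M + k)" using k by (auto simp: M_def)
      then show ?thesis unfolding x1_def x2_def power_add [symmetric] by simp
    qed
    have P: "inv_euler_poly (M - k - 1) = (1 - x1) * P"
      using k inv_euler_poly_pred [of "M - k"] by (simp add: P_def x1_def)
    have Q: "inv_euler_poly (M + k - 1) = (1 - x2) * Q"
      using k inv_euler_poly_pred [of "M + k"] by (simp add: Q_def x2_def)
    have e: "nat (k ^ 2 + k + M) = nat (k ^ 2) + nat (M + k)"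
      "nat ((k - 1) ^ 2 + (k - 1) + M) = nat (k ^ 2) + nat (M - k)"
    proof -
      have "k ^ 2 + k + M = k ^ 2 + (M + k)" "(k - 1) ^ 2 + (k - 1) + M = k ^ 2 + (M - k)"
        by (simp_all add: power2_eq_square algebra_simps)
      then show "nat (k ^ 2 + k + M) = nat (k ^ 2) + nat (M + k)"
        "nat ((k - 1) ^ 2 + (k - 1) + M) = nat (k ^ 2) + nat (M - k)"
        using k by (simp_all only: nat_add_distrib zero_le_power2) (auto simp: nat_add_distrib)
    qed
    have "v k = \<sigma> k * (y * x2) * ((1 - x1) * P * Q)"
      by (simp add: v_def e P power_add Q_def y_def x2_def)
    moreover have "v (k - 1) = - \<sigma> k * (y * x1) * (P * ((1 - x2) * Q))"
    proof -
      have eqs: "M - (k - 1) - 1 = M - k" "M + (k - 1) = M + k - 1" by auto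
      show ?thesis
        unfolding v_def e eqs Q P_def [symmetric] \<sigma>_def minus_one_power_nat_pred power_add
          y_def [symmetric] x1_def [symmetric] ..
    qed
    moreover have "u M k = \<sigma> k * y * (P * Q)"
      by (simp add: u_def y_def P_def Q_def)
    moreover have "u (M - 1) k = \<sigma> k * y * ((1 - x1) * P * ((1 - x2) * Q))"
    proof -
      have eqs: "M - 1 - k = M - k - 1" "M - 1 + k = M + k - 1" by auto
      show ?thesis unfolding u_def eqs P Q y_def ..
    qed
    ultimately show ?thesis
      unfolding x12 by (simp only:) (simp add: algebra_simps)
  qed
  have "(\<Sum>k\<in>{-M..M}. v (k - 1)) = (\<Sum>k\<in>{-M-1..M-1}. v k)"
    by (rule sum.reindex_bij_witness [of _ "\<lambda>k. k + 1" "\<lambda>k. k - 1"]) auto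
  also have "\<dots> = (\<Sum>k\<in>{-M..M-1}. v k)"
    by (rule sum.mono_neutral_right) (auto simp: v_def inv_euler_poly_def)
  also have "\<dots> = (\<Sum>k\<in>{-M..M}. v k)"
    by (rule sum.mono_neutral_left) (auto simp: v_def inv_euler_poly_def)
  finally have tel: "(\<Sum>k\<in>{-M..M}. v k - v (k - 1)) = 0"
    by (simp add: sum_subtractf)
  \<comment> \<open>The indices \<open>k = M\<close> and \<open>k = - M\<close> may be added, since
    an argument of \<open>inv_euler_poly\<close> is negative there.\<close>
  have "gauss_sum N = (\<Sum>k\<in>{-M..M}. u (M - 1) k)"
    unfolding gauss_sum_def u_def \<sigma>_def M_def
    by (simp, intro sum.mono_neutral_left) (auto simp: inv_euler_poly_def)
  moreover have "gauss_sum (Suc N) = (\<Sum>k\<in>{-M..M}. u M k)"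
    by (simp add: gauss_sum_def u_def \<sigma>_def M_def)
  ultimately have "(1 - fps_X ^ (2 * Suc N)) * gauss_sum (Suc N) - gauss_sum N
      = (\<Sum>k\<in>{-M..M}. v k - v (k - 1))"
    by (simp only: sum_distrib_left sum_subtractf [symmetric]) (intro sum.cong refl step)
  with tel show ?thesis by simp
qed

lemma gauss_sum_eq: "dilate (euler_poly N) * gauss_sum N = 1"
proof (induction N)
  case 0
  then show ?case by (simp add: gauss_sum_def inv_euler_poly_def)
next
  case (Suc N)
  have "dilate (euler_poly (Suc N)) * gauss_sum (Suc N)
      = dilate (euler_poly N) * ((1 - fps_X ^ (2 * Suc N)) * gauss_sum (Suc N))"
    by (simp add: euler_poly_Suc power_mult [symmetric] mult.assoc del: power_Suc)
  then show ?case by (simp only: gauss_sum_Suc Suc.IH)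
qed

lemma theta4_cong:
  "fps_X ^ Suc N dvd (\<Sum>k\<in>{- int N..int N}. (-1) ^ nat \<bar>k\<bar> * fps_X ^ nat (k ^ 2)) - theta4"
proof -
  have "(\<Sum>k\<in>{- int N..int N}. (-1) ^ nat \<bar>k\<bar> * fps_X ^ nat (k ^ 2)) $ n = theta4 $ n"
    if "n \<le> N" for n
  proof -
    have "(\<Sum>k\<in>{- int N..int N}. (-1) ^ nat \<bar>k\<bar> * fps_X ^ nat (k ^ 2)) $ n
        = (\<Sum>k\<in>{- int N..int N}. if k \<in> sq_reps n then (-1 :: rat) ^ n else 0)"
      unfolding fps_sum_nth
    proof (intro sum.cong refl)
      fix k :: int
      have "nat (k ^ 2) = n \<longleftrightarrow> k \<in> sq_reps n" by (auto simp: sq_reps_def)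
      moreover have "even k \<longleftrightarrow> even n" if "k \<in> sq_reps n"
      proof -
        have "even (k ^ 2) \<longleftrightarrow> even (int n)" using that by (simp add: sq_reps_def)
        then show ?thesis by simp
      qed
      ultimately show "((-1) ^ nat \<bar>k\<bar> * fps_X ^ nat (k ^ 2)) $ n
          = (if k \<in> sq_reps n then (-1 :: rat) ^ n else 0)"
        by (auto simp: minus_one_power_iff even_nat_iff fps_X_power_nth)
    qed
    also have "\<dots> = (\<Sum>k\<in>{- int N..int N} \<inter> sq_reps n. (-1) ^ n)"
      by (rule sum.inter_restrict [symmetric]) auto
    also have "{- int N..int N} \<inter> sq_reps n = sq_reps n"
    proof -
      have "k \<in> {- int N..int N}" if "k \<in> sq_reps n" for k
        using that \<open>n \<le> N\<close> abs_le_square_int [of k] by (auto simp: sq_reps_def)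
      then show ?thesis by auto
    qed
    finally show ?thesis by (simp add: theta4_def mult.commute)
  qed
  then show ?thesis by (simp add: fps_X_power_dvd_iff del: power_Suc)
qed

text \<open>Gauss's product for \<open>theta4\<close> is the limit of \<open>gauss_sum_eq\<close>,
  taken modulo each power of q.\<close>

lemma theta4_euler: "theta4 * dilate euler = euler ^ 2"
proof (rule fps_eqI_mod_X_powers)
  fix n :: nat
  \<comment> \<open>For \<open>|k| <= n\<close> both \<open>N - k\<close> and \<open>N + k\<close>
    are then at least n, so the reciprocals can be replaced by \<open>1 / euler\<close>; every other
    k only contributes beyond \<open>q^n\<close>.\<close>
  define N where "N = 2 * n"
  define Z where "Z = (fps_X ^ Suc n :: rat fps)"
  define \<Theta> where "\<Theta> = (\<Sum>k\<in>{- int N..int N}. (-1) ^ nat \<bar>k\<bar> * fps_X ^ nat (k ^ 2) :: rat fps)"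
  have "Z dvd (fps_X ^ Suc N :: rat fps)"
    unfolding Z_def N_def by (intro le_imp_power_dvd) auto
  then have 1: "Z dvd \<Theta> - theta4" and 2: "Z dvd dilate euler - dilate (euler_poly N)"
    using theta4_cong [of N] dilate_X_power_dvd [OF euler_cong [of N]] unfolding \<Theta>_def
    by (auto intro: dvd_trans)
  have "Z dvd euler ^ 2 * gauss_sum N - \<Theta>"
  proof -
    have "Z dvd (-1) ^ nat \<bar>k\<bar> * fps_X ^ nat (k ^ 2) *
       ((euler * inv_euler_poly (int N - k)) * (euler * inv_euler_poly (int N + k)) - 1)" for k
    proof (cases "\<bar>k\<bar> \<le> int n")
      case True
      define P where "P = euler * inv_euler_poly (int N - k)"
      define Q where "Q = euler * inv_euler_poly (int N + k)"
      have "Z dvd P - 1" "Z dvd Q - 1"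
        unfolding Z_def P_def Q_def using True by (auto intro!: inv_euler_poly_cong simp: N_def simp del: power_Suc)
      then have "Z dvd (P - 1) * Q + (Q - 1)" by (intro dvd_add dvd_mult2)
      also have "(P - 1) * Q + (Q - 1) = P * Q - 1" by (simp add: algebra_simps)
      finally show ?thesis unfolding P_def Q_def by (rule dvd_mult)
    next
      case False
      then have "Suc n \<le> nat (k ^ 2)"
        using abs_le_square_int [of k] by linarith
      then have "Z dvd fps_X ^ nat (k ^ 2)" unfolding Z_def by (rule le_imp_power_dvd)
      then show ?thesis by (intro dvd_mult2 dvd_mult)
    qed
    then have "Z dvd (\<Sum>k\<in>{- int N..int N}. (-1) ^ nat \<bar>k\<bar> * fps_X ^ nat (k ^ 2) *
       ((euler * inv_euler_poly (int N - k)) * (euler * inv_euler_poly (int N + k)) - 1))"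
      by (rule dvd_sum)
    also have "\<dots> = euler ^ 2 * gauss_sum N - \<Theta>"
      unfolding gauss_sum_def \<Theta>_def sum_distrib_left sum_subtractf [symmetric]
      by (intro sum.cong) (simp_all add: algebra_simps power2_eq_square)
    finally show ?thesis .
  qed
  with 1 have "Z dvd (euler ^ 2 * gauss_sum N - \<Theta>) + (\<Theta> - theta4)" by (rule dvd_add[rotated])
  then have "Z dvd dilate (euler_poly N) * (theta4 - euler ^ 2 * gauss_sum N)"
    by (intro dvd_mult) (simp add: dvd_diff_commute)
  then have "Z dvd dilate (euler_poly N) * (theta4 - euler ^ 2 * gauss_sum N)
     + (dilate euler - dilate (euler_poly N)) * theta4"
    using 2 by (metis dvd_add dvd_mult2)
  also have "\<dots> = theta4 * dilate euler - euler ^ 2 * (dilate (euler_poly N) * gauss_sum N)"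
    by (simp add: algebra_simps)
  finally show "fps_X ^ Suc n dvd theta4 * dilate euler - euler ^ 2"
    unfolding gauss_sum_eq Z_def by simp
qed

section \<open>Hypergeometric parametrisation of the eta quotient\<close>

lemma sq_reps_0: "sq_reps 0 = {0}" and sq_reps_1: "sq_reps 1 = {1, -1}"
  by (auto simp: sq_reps_def power2_eq_1_iff)

lemma theta_nth_0 [simp]: "theta3 $ 0 = 1" "theta4 $ 0 = 1"
  and theta_nth_1 [simp]: "theta3 $ Suc 0 = 2" "theta4 $ Suc 0 = -2"
  by (simp_all add: theta3_def theta4_def sq_reps_0 sq_reps_1 [unfolded One_nat_def])

lemma fps_square_nth_1: "(f ^ 2) $ Suc 0 = 2 * f $ 0 * (f :: rat fps) $ Suc 0"
  by (simp add: power2_eq_square fps_mult_nth_1 [unfolded One_nat_def])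

text \<open>The series \<open>eta(2z)^12 / q\<close>, whose coefficient at \<open>q^(n-1)\<close> is
  \<open>gamma(n)\<close>.\<close>

definition eta_prod :: "rat fps" where
  "eta_prod = dilate euler ^ 12"

lemma eta_prod_nth_0 [simp]: "eta_prod $ 0 = 1"
  by (simp add: eta_prod_def fps_power_zeroth)

text \<open>Divided by 16q, both sides satisfy \<open>f ^ 2 = dilate theta4 ^ 12 * dilate f\<close>:
  one by Gauss's product, the other by the doubling formulas. Their quotient r has
  \<open>dilate r = r ^ 2\<close>, so it is 1.\<close>

lemma eta_prod_theta:
  "16 * (fps_X * eta_prod) = theta3 ^ 4 * theta4 ^ 4 * (theta3 ^ 4 - theta4 ^ 4)"
proof -
  define a where "a = theta3 ^ 2"
  define b where "b = theta4 ^ 2"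
  define \<Theta> where "\<Theta> = dilate theta4 ^ 12"
  define M where "M = fps_const (1 / 16) * (a ^ 2 * b ^ 2 * (a ^ 2 - b ^ 2))"
  define m where "m = fps_shift 1 M"
  have a4: "theta3 ^ 4 = a ^ 2" "theta4 ^ 4 = b ^ 2"
    by (simp_all add: a_def b_def flip: power_mult)
  have "(16 :: rat fps) * fps_const (1 / 16) = 1"
    by (simp add: numeral_fps_const)
  then have M16: "16 * M = a ^ 2 * b ^ 2 * (a ^ 2 - b ^ 2)"
    by (simp add: M_def mult.assoc [symmetric])
  have ab01: "a $ 0 = 1" "b $ 0 = 1" "a $ Suc 0 = 4" "b $ Suc 0 = -4"
    by (simp_all add: a_def b_def fps_power_zeroth fps_square_nth_1)
  then have "M $ 0 = 0" and m0: "m $ 0 = 1"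
    by (simp_all add: M_def m_def fps_power_zeroth fps_mult_nth_1 [unfolded One_nat_def] fps_square_nth_1)
  then have Mm: "M = fps_X * m"
    by (auto simp: m_def fps_eq_iff)
  have sum: "a + b = 2 * dilate a"
    unfolding a_def b_def by (rule theta_square_sum)
  have prod: "a * b = dilate b ^ 2"
    unfolding a_def b_def theta_prod [symmetric] by (simp add: power_mult_distrib mult.commute)
  have \<Theta>: "\<Theta> = (a * b) ^ 3"
    unfolding prod by (simp add: \<Theta>_def b_def flip: power_mult)
  \<comment> \<open>Elimination: \<open>sum\<close> and \<open>prod\<close> give
    \<open>dilate a ^ 2 - dilate b ^ 2 = (a - b)^2 / 4\<close>. The factor 256 clears the
    denominators.\<close>
  have "256 * M ^ 2 = 256 * (\<Theta> * dilate M)"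
  proof -
    have "dilate (16 * M) = dilate a ^ 2 * dilate b ^ 2 * (dilate a ^ 2 - dilate b ^ 2)"
      by (simp add: M16)
    then have "16 * dilate M = dilate a ^ 2 * dilate b ^ 2 * (dilate a ^ 2 - dilate b ^ 2)"
      by simp
    with M16 sum prod show ?thesis unfolding \<Theta> by algebra
  qed
  then have M2: "M ^ 2 = \<Theta> * dilate M" by simp
  have "fps_X ^ 2 * (m ^ 2) = fps_X ^ 2 * (\<Theta> * dilate m)"
    using M2 unfolding Mm by (simp add: power_mult_distrib algebra_simps)
  then have m2: "m ^ 2 = \<Theta> * dilate m" by simp
  have "eta_prod ^ 2 = dilate (euler ^ 2) ^ 12"
    by (simp add: eta_prod_def flip: power_mult)
  also have "\<dots> = \<Theta> * dilate eta_prod"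
    by (simp add: theta4_euler [symmetric] \<Theta>_def eta_prod_def power_mult_distrib)
  finally have e2: "eta_prod ^ 2 = \<Theta> * dilate eta_prod" .
  define r where "r = m * inverse eta_prod"
  have r: "r * eta_prod = m"
    by (simp add: r_def mult.assoc inverse_mult_eq_1)
  have "dilate r * eta_prod ^ 2 = \<Theta> * dilate (r * eta_prod)"
    unfolding e2 by simp
  also have "\<dots> = r ^ 2 * eta_prod ^ 2"
    unfolding r m2 [symmetric] by (simp add: r [symmetric] power_mult_distrib)
  finally have "dilate r = r ^ 2"
    by (metis eta_prod_nth_0 fps_zero_nth mult_right_cancel power_eq_0_iff zero_neq_one)
  then have "r = 1" by (rule dilate_eq_square) (simp add: r_def m0)
  with r have "m = eta_prod" by simp
  then show ?thesis using M16 unfolding a4 Mm by simp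
qed

section \<open>The modular function t and its behaviour under doubling\<close>

definition hauptmodul_inv :: "rat fps" where
  "hauptmodul_inv = theta3 ^ 8 * theta4 ^ 4 * inverse eta_prod"

text \<open>One sixteenth of the modular lambda function in the nome q. Building it from the unit
  \<open>q / t\<close> gives its product form at once; the theta form is
  \<open>hauptmodul_theta\<close>.\<close>

definition hauptmodul :: "rat fps" where
  "hauptmodul = fps_X * inverse hauptmodul_inv"

lemma hauptmodul_inv_nth_0 [simp]: "hauptmodul_inv $ 0 = 1"
  by (simp add: hauptmodul_inv_def fps_power_zeroth)

lemma hauptmodul_nth_0 [simp]: "hauptmodul $ 0 = 0"
  by (simp add: hauptmodul_def)

lemma hauptmodul_mult_inv: "hauptmodul * hauptmodul_inv = fps_X"
  by (simp add: hauptmodul_def mult.assoc inverse_mult_eq_1)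

lemma hauptmodul_eta: "hauptmodul * (theta3 ^ 8 * theta4 ^ 4) = fps_X * eta_prod"
proof -
  have "hauptmodul_inv * eta_prod = theta3 ^ 8 * theta4 ^ 4"
    by (simp add: hauptmodul_inv_def mult.assoc inverse_mult_eq_1)
  then show ?thesis
    by (metis hauptmodul_mult_inv mult.assoc)
qed

lemma hauptmodul_theta: "16 * hauptmodul * theta3 ^ 4 = theta3 ^ 4 - theta4 ^ 4"
proof -
  have "(theta3 ^ 4 * theta4 ^ 4) $ 0 \<noteq> 0" by (simp add: fps_power_zeroth)
  then have nz: "theta3 ^ 4 * theta4 ^ 4 \<noteq> 0" by (metis fps_zero_nth)
  have "(theta3 ^ 4 * theta4 ^ 4) * (16 * hauptmodul * theta3 ^ 4) = 16 * (hauptmodul * (theta3 ^ 8 * theta4 ^ 4))"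
    by (simp add: algebra_simps flip: power_add)
  also have "\<dots> = (theta3 ^ 4 * theta4 ^ 4) * (theta3 ^ 4 - theta4 ^ 4)"
    unfolding hauptmodul_eta by (rule eta_prod_theta)
  finally show ?thesis using nz by (metis mult_left_cancel)
qed

text \<open>The square root of \<open>dilate hauptmodul\<close> with leading term q, which is the
  variable of Landen's transformation.\<close>

definition sqrt_hauptmodul :: "rat fps" where
  "sqrt_hauptmodul = fps_const (1 / 8) * (theta3 ^ 2 - theta4 ^ 2) * inverse (dilate (theta3 ^ 2))"

lemma sqrt_hauptmodul_nth_0 [simp]: "sqrt_hauptmodul $ 0 = 0"
  by (simp add: sqrt_hauptmodul_def fps_power_zeroth)

lemma sqrt_hauptmodul_mult:
  "8 * sqrt_hauptmodul * dilate (theta3 ^ 2) = theta3 ^ 2 - theta4 ^ 2"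
proof -
  have "inverse (dilate (theta3 ^ 2)) * dilate (theta3 ^ 2) = 1"
    by (intro inverse_mult_eq_1) (simp add: fps_power_zeroth)
  moreover have "8 * fps_const (1 / 8) = (1 :: rat fps)"
    by (simp add: numeral_fps_const)
  ultimately show ?thesis unfolding sqrt_hauptmodul_def by algebra
qed

lemma fps_neq_0I: "f $ 0 \<noteq> 0 \<Longrightarrow> (f :: rat fps) \<noteq> 0"
  by (metis fps_zero_nth)

lemma sqrt_hauptmodul_theta:
  "(1 + 4 * sqrt_hauptmodul) * dilate (theta3 ^ 2) = theta3 ^ 2"
proof -
  have "2 * ((1 + 4 * sqrt_hauptmodul) * dilate (theta3 ^ 2)) = 2 * theta3 ^ 2"
    using theta_square_sum sqrt_hauptmodul_mult by algebra
  then show ?thesis by simp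
qed

text \<open>For an arithmetic-geometric mean step from (a, b) to (A, B), the difference
  \<open>A^2 - B^2 = (a - b)^2 / 4\<close> is a perfect square.\<close>

lemma dilate_hauptmodul: "dilate hauptmodul = sqrt_hauptmodul ^ 2"
proof -
  define A where "A = dilate (theta3 ^ 2)"
  define B where "B = dilate (theta4 ^ 2)"
  have "A $ 0 \<noteq> 0" by (simp add: A_def fps_power_zeroth)
  then have A0: "64 * A ^ 2 \<noteq> 0" using fps_neq_0I by simp
  have 1: "dilate (16 * hauptmodul * theta3 ^ 4) = A ^ 2 - B ^ 2"
    unfolding hauptmodul_theta by (simp add: A_def B_def flip: power_mult)
  have "dilate (16 * hauptmodul * theta3 ^ 4) = 16 * dilate hauptmodul * A ^ 2"
    by (simp add: A_def flip: power_mult)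
  moreover have "B ^ 2 = theta3 ^ 2 * theta4 ^ 2"
    unfolding B_def theta_prod [symmetric] by algebra
  moreover note theta_square_sum [folded A_def] sqrt_hauptmodul_mult [folded A_def] 1
  ultimately have "64 * A ^ 2 * dilate hauptmodul = 64 * A ^ 2 * sqrt_hauptmodul ^ 2"
    by algebra
  with A0 show ?thesis by (metis mult_left_cancel)
qed

text \<open>The relation of t to its doubled version in Landen's form, which makes
  \<open>binom_sq_fps_landen\<close> applicable to t.\<close>

lemma hauptmodul_sqrt: "hauptmodul * (1 + 4 * sqrt_hauptmodul) ^ 2 = sqrt_hauptmodul"
proof -
  define A where "A = dilate (theta3 ^ 2)"
  have "A $ 0 \<noteq> 0" by (simp add: A_def fps_power_zeroth)
  then have A0: "16 * A ^ 2 \<noteq> 0" using fps_neq_0I by simp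
  have "16 * hauptmodul * (theta3 ^ 2) ^ 2 = (theta3 ^ 2) ^ 2 - (theta4 ^ 2) ^ 2"
    using hauptmodul_theta by (simp flip: power_mult)
  with theta_square_sum [folded A_def] sqrt_hauptmodul_mult [folded A_def] sqrt_hauptmodul_theta [folded A_def]
  have "16 * A ^ 2 * (hauptmodul * (1 + 4 * sqrt_hauptmodul) ^ 2) = 16 * A ^ 2 * sqrt_hauptmodul"
    by algebra
  with A0 show ?thesis by (metis mult_left_cancel)
qed

section \<open>The operator q d/dq and the hypergeometric series\<close>

abbreviation XD :: "rat fps \<Rightarrow> rat fps" where
  "XD \<equiv> fps_XD"

lemma XD_eq: "XD f = fps_X * fps_deriv f"
  by (simp add: fps_XD_def)

lemma XD_add: "XD (f + g) = XD f + XD g"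
  and XD_diff: "XD (f - g) = XD f - XD g"
  and XD_mult: "XD (f * g) = XD f * g + f * XD g"
  and XD_numeral [simp]: "XD (numeral k) = 0"
  and XD_1 [simp]: "XD 1 = 0"
  and XD_X [simp]: "XD fps_X = fps_X"
  by (simp_all add: XD_eq algebra_simps)

lemma XD_square: "XD (f ^ 2) = 2 * f * XD f"
  by (simp add: power2_eq_square XD_mult)

lemma XD_dilate: "XD (dilate f) = 2 * dilate (XD f)"
  by (auto simp: fps_eq_iff dilate_nth numeral_fps_const elim!: evenE)

text \<open>Here k is the logarithmic derivative of g; the chain rule carries differential equations
  in t over to q.\<close>

lemma XD_compose:
  assumes "g $ 0 = 0" and "XD g = k * g"
  shows "XD (f oo g) = k * (XD f oo g)"
proof -
  have "XD (f oo g) = (fps_deriv f oo g) * XD g"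
    by (simp add: XD_eq fps_compose_deriv assms)
  also have "\<dots> = k * (g * (fps_deriv f oo g))" by (simp add: assms)
  also have "g * (fps_deriv f oo g) = XD f oo g"
    by (simp add: XD_eq fps_compose_mult_distrib assms)
  finally show ?thesis .
qed

lemma XD_inverse:
  assumes "f $ 0 \<noteq> 0"
  shows "XD (inverse f) = - XD f * inverse f ^ 2"
  using fps_inverse_deriv [OF assms] by (simp add: XD_eq algebra_simps)

text \<open>The hypergeometric series \<open>2F1(1/2, 1/2; 1; 16x)\<close>.\<close>

definition binom_sq_fps :: "rat fps" where
  "binom_sq_fps = Abs_fps (\<lambda>n. of_nat ((2 * n) choose n) ^ 2)"

lemma central_binomial_Suc:
  "Suc n * (2 * Suc n choose Suc n) = 2 * (2 * n + 1) * (2 * n choose n)"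
proof -
  have "Suc n * (2 * Suc n choose Suc n) = (2 * Suc n) * (2 * n + 1 choose n)"
    using Suc_times_binomial_eq [of "2 * n + 1" n] by (simp add: mult.commute)
  also have "(2 * n + 1 choose n) = (2 * n + 1 choose Suc n)"
    using binomial_symmetric [of n "2 * n + 1"] by simp
  also have "Suc n * (Suc (2 * n) choose Suc n) = Suc (2 * n) * (2 * n choose n)"
    by (metis Suc_times_binomial_eq mult.commute)
  then have "(2 * Suc n) * (2 * n + 1 choose Suc n) = 2 * (2 * n + 1) * (2 * n choose n)"
    by simp
  finally show ?thesis .
qed

lemma binom_sq_fps_Suc:
  "(of_nat n + 1) ^ 2 * binom_sq_fps $ Suc n = 4 * (2 * of_nat n + 1) ^ 2 * binom_sq_fps $ n"
proof -
  have "rat_of_nat (Suc n * (2 * Suc n choose Suc n)) = of_nat (2 * (2 * n + 1) * (2 * n choose n))"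
    by (simp only: central_binomial_Suc)
  then have "(of_nat n + 1) * rat_of_nat (2 * Suc n choose Suc n)
      = 2 * (2 * of_nat n + 1) * of_nat (2 * n choose n)"
    by (simp add: algebra_simps)
  then have "((of_nat n + 1) * rat_of_nat (2 * Suc n choose Suc n)) ^ 2
      = (2 * (2 * of_nat n + 1) * of_nat (2 * n choose n)) ^ 2"
    by simp
  then show ?thesis
    unfolding binom_sq_fps_def fps_nth_Abs_fps by (simp only: power_mult_distrib) simp
qed

lemma binom_sq_fps_nth_0 [simp]: "binom_sq_fps $ 0 = 1"
  by (simp add: binom_sq_fps_def)

lemma numeral_X_mult_nth_Suc: "(numeral k * fps_X * f) $ Suc n = numeral k * (f :: rat fps) $ n"
  by (simp add: numeral_fps_const mult.assoc)

lemma binom_sq_fps_ode: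
  "(1 - 16 * fps_X) * XD (XD binom_sq_fps) = 16 * fps_X * XD binom_sq_fps + 4 * fps_X * binom_sq_fps"
proof (rule fps_ext)
  fix n
  show "((1 - 16 * fps_X) * XD (XD binom_sq_fps)) $ n
      = (16 * fps_X * XD binom_sq_fps + 4 * fps_X * binom_sq_fps) $ n"
  proof (cases n)
    case (Suc m)
    then show ?thesis
      using binom_sq_fps_Suc [of m]
      unfolding left_diff_distrib fps_sub_nth fps_add_nth Suc numeral_X_mult_nth_Suc fps_XD_nth
      by (simp add: algebra_simps power2_eq_square)
  qed (simp add: algebra_simps)
qed

lemma numeral_X2_mult_nth:
  "(numeral k * fps_X ^ 2 * f) $ n = (if n < 2 then 0 else numeral k * (f :: rat fps) $ (n - 2))"
  by (simp add: numeral_fps_const mult.assoc fps_X_power_mult_nth)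

text \<open>Landen's transformation: after division by \<open>1 + 4x\<close> the left-hand side satisfies the
  differential equation of \<open>F(x\<^sup>2)\<close>, which has only one power series solution up to scaling.\<close>

lemma binom_sq_fps_landen:
  "binom_sq_fps oo (fps_X * inverse (1 + 4 * fps_X) ^ 2) = (1 + 4 * fps_X) * dilate binom_sq_fps"
proof -
  define i where "i = inverse (1 + 4 * fps_X :: rat fps)"
  define \<tau> where "\<tau> = fps_X * i ^ 2"
  \<comment> \<open>The logarithmic derivative of \<open>\<tau>\<close>, that is of
    \<open>x / (1 + 4x)^2\<close>.\<close>
  define \<kappa> where "\<kappa> = (1 - 4 * fps_X) * i"
  define F0 where "F0 = binom_sq_fps oo \<tau>"
  define F1 where "F1 = XD binom_sq_fps oo \<tau>"
  define F2 where "F2 = XD (XD binom_sq_fps) oo \<tau>"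
  define P where "P = i * F0"
  have c0: "(1 + 4 * fps_X :: rat fps) $ 0 \<noteq> 0" by simp
  then have ci: "(1 + 4 * fps_X) * i = 1" unfolding i_def by (rule inverse_mult_eq_1')
  have XDi: "XD i = - 4 * fps_X * i ^ 2"
    unfolding i_def XD_inverse [OF c0] by (simp add: XD_add XD_mult)
  have XDt: "XD \<tau> = \<kappa> * \<tau>"
    unfolding \<tau>_def \<kappa>_def XD_mult XD_square XDi XD_X using ci by algebra
  have XDk: "XD \<kappa> = - 8 * fps_X * i ^ 2"
    unfolding \<kappa>_def XD_mult XD_diff XDi XD_X XD_1 XD_numeral using ci by algebra
  have \<tau>0: "\<tau> $ 0 = 0" by (simp add: \<tau>_def)
  have "(1 - 16 * \<tau>) * F2 = 16 * \<tau> * F1 + 4 * \<tau> * F0"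
    using arg_cong [OF binom_sq_fps_ode, of "\<lambda>f. f oo \<tau>"] \<tau>0
    by (simp add: fps_compose_mult_distrib fps_compose_add_distrib fps_compose_sub_distrib
        F0_def F1_def F2_def)
  moreover have XD0: "XD F0 = \<kappa> * F1" "XD F1 = \<kappa> * F2"
    unfolding F0_def F1_def F2_def by (rule XD_compose [OF \<tau>0 XDt])+
  have XDP: "XD P = - 4 * fps_X * i ^ 2 * F0 + i * \<kappa> * F1"
    unfolding P_def XD_mult XDi XD0 by (simp add: algebra_simps)
  have XDDP: "XD (XD P) = (32 * fps_X ^ 2 * i ^ 3 - 4 * fps_X * i ^ 2) * F0
      - 8 * fps_X * i ^ 2 * \<kappa> * F1 - 8 * fps_X * i ^ 3 * F1 + i * \<kappa> ^ 2 * F2"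
  proof -
    have "XD (- 4 * fps_X * i ^ 2) = 32 * fps_X ^ 2 * i ^ 3 - 4 * fps_X * i ^ 2"
    proof -
      have "XD (- 4 * fps_X * i ^ 2) = XD (- 4) * (fps_X * i ^ 2) - 4 * XD (fps_X * i ^ 2)"
        using XD_mult [of "- 4" "fps_X * i ^ 2"] by (simp add: mult.assoc)
      moreover have "XD (- 4) = 0" by (simp add: fps_eq_iff XD_eq)
      ultimately show ?thesis
        unfolding XD_mult XD_square XDi XD_X by (simp add: power2_eq_square power3_eq_cube algebra_simps)
    qed
    note q = this
    show ?thesis
      unfolding XDP XD_add XD_mult [of _ F0] XD_mult [of _ F1] XD_mult [of i] q XDi XDk XD0
      by (simp add: power2_eq_square power3_eq_cube algebra_simps)
  qed
  \<comment> \<open>The equation of \<open>F(x^2)\<close>: the substitution doubles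
    \<open>XD\<close>, which turns the factors 16 and 4 on the right into 32 and 16.\<close>
  have "(1 - 16 * fps_X ^ 2) * XD (XD P) = 32 * fps_X ^ 2 * XD P + 16 * fps_X ^ 2 * P"
  proof -
    have "(1 - 16 * \<tau>) * F2 = 16 * \<tau> * F1 + 4 * \<tau> * F0" by fact
    then have k2: "\<kappa> ^ 2 * F2 = 16 * fps_X * i ^ 2 * F1 + 4 * fps_X * i ^ 2 * F0"
      unfolding \<tau>_def \<kappa>_def using ci by algebra
    have i1: "i = i ^ 2 + 4 * fps_X * i ^ 2" and i2: "i ^ 2 = i ^ 3 + 4 * fps_X * i ^ 3"
      using arg_cong [OF ci, of "\<lambda>f. f * i"] arg_cong [OF ci, of "\<lambda>f. f * i ^ 2"]
      by (simp_all add: algebra_simps power2_eq_square power3_eq_cube)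
    have "i * \<kappa> ^ 2 * F2 = i * (\<kappa> ^ 2 * F2)" by (simp only: mult.assoc)
    also have "\<dots> = 16 * fps_X * i ^ 3 * F1 + 4 * fps_X * i ^ 3 * F0"
      unfolding k2 by (simp add: algebra_simps power2_eq_square power3_eq_cube)
    finally have "XD (XD P) = (32 * fps_X ^ 2 * i ^ 3 - 4 * fps_X * i ^ 2 + 4 * fps_X * i ^ 3) * F0
        + 32 * fps_X ^ 2 * i ^ 3 * F1"
      unfolding XDDP by (simp add: \<kappa>_def algebra_simps power2_eq_square power3_eq_cube)
    also have "32 * fps_X ^ 2 * i ^ 3 - 4 * fps_X * i ^ 2 + 4 * fps_X * i ^ 3 = 16 * fps_X ^ 2 * i ^ 3"
      by (subst i2) (simp add: algebra_simps power2_eq_square)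
    finally have "(1 - 16 * fps_X ^ 2) * XD (XD P)
        = (1 - 4 * fps_X) * (16 * fps_X ^ 2 * F0 + 32 * fps_X ^ 2 * F1) * (i ^ 3 + 4 * fps_X * i ^ 3)"
      by (simp add: algebra_simps power2_eq_square)
    also have "\<dots> = (1 - 4 * fps_X) * (16 * fps_X ^ 2 * F0 + 32 * fps_X ^ 2 * F1) * i ^ 2"
      by (simp only: i2 [symmetric])
    also have "\<dots> = 32 * fps_X ^ 2 * XD P + 16 * fps_X ^ 2 * ((i ^ 2 + 4 * fps_X * i ^ 2) * F0)"
      unfolding XDP \<kappa>_def by (simp add: algebra_simps power2_eq_square)
    also have "(i ^ 2 + 4 * fps_X * i ^ 2) * F0 = P"
      unfolding P_def by (simp only: i1 [symmetric])
    finally show ?thesis .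
  qed
  then have ode: "((1 - 16 * fps_X ^ 2) * XD (XD P)) $ n
      = (32 * fps_X ^ 2 * XD P + 16 * fps_X ^ 2 * P) $ n" for n by simp
  have P0: "P $ 0 = 1" by (simp add: P_def F0_def i_def)
  \<comment> \<open>The equation itself forces the coefficient at 1 to vanish, so the two-step
    recursion below leaves only one solution.\<close>
  have P1: "P $ 1 = 0"
    using ode [of 1]
    unfolding left_diff_distrib fps_sub_nth fps_add_nth numeral_X2_mult_nth fps_XD_nth by simp
  have PSS: "(of_nat n + 2) ^ 2 * P $ (n + 2) = 16 * (of_nat n + 1) ^ 2 * P $ n" for n
    using ode [of "n + 2"]
    unfolding left_diff_distrib fps_sub_nth fps_add_nth numeral_X2_mult_nth fps_XD_nth
    by (simp add: algebra_simps power2_eq_square)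
  have "P $ n = dilate binom_sq_fps $ n" for n
  proof (induction n rule: less_induct)
    case (less n)
    consider "n = 0" | "n = 1" | m where "n = m + 2"
      by (metis One_nat_def add_2_eq_Suc' not0_implies_Suc)
    then show ?case
    proof cases
      case 3
      have "(of_nat m + 2) ^ 2 * dilate binom_sq_fps $ (m + 2) = 16 * (of_nat m + 1) ^ 2 * dilate binom_sq_fps $ m"
      proof (cases "even m")
        case True
        then obtain k where "m = 2 * k" by (elim evenE)
        then show ?thesis
          using binom_sq_fps_Suc [of k] by (simp add: dilate_nth power2_eq_square algebra_simps)
      qed (simp add: dilate_nth)
      then have "(of_nat m + 2) ^ 2 * P $ n = (of_nat m + 2) ^ 2 * dilate binom_sq_fps $ n"
        using PSS [of m] less.IH [of m] 3 by simp
      moreover have "(rat_of_nat m + 2) ^ 2 \<noteq> 0"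
        by (metis add_2_eq_Suc' nat.simps(3) of_nat_add of_nat_eq_0_iff of_nat_numeral power_eq_0_iff)
      ultimately show ?thesis by (metis mult_left_cancel)
    qed (use P0 P1 in \<open>simp_all add: dilate_nth\<close>)
  qed
  then have "P = dilate binom_sq_fps" by (simp add: fps_eq_iff)
  moreover have "(1 + 4 * fps_X) * P = F0"
    unfolding P_def using ci by (simp flip: mult.assoc)
  ultimately show ?thesis
    by (simp add: F0_def \<tau>_def i_def)
qed

section \<open>Jacobi's relations for t\<close>

lemma hauptmodul_eq_compose:
  "hauptmodul = (fps_X * inverse (1 + 4 * fps_X) ^ 2) oo sqrt_hauptmodul"
proof -
  define s where "s = sqrt_hauptmodul"
  have s0: "s $ 0 = 0" by (simp add: s_def)
  have "(fps_X * inverse (1 + 4 * fps_X) ^ 2) oo s = s * inverse (1 + 4 * s) ^ 2"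
    using s0 by (simp add: fps_compose_mult_distrib fps_compose_power [symmetric] fps_inverse_compose
        fps_compose_add_distrib)
  also have "\<dots> = hauptmodul * ((1 + 4 * s) * inverse (1 + 4 * s)) ^ 2"
    using hauptmodul_sqrt [folded s_def] by (simp only: power_mult_distrib mult.assoc [symmetric])
  also have "(1 + 4 * s) * inverse (1 + 4 * s) = 1"
    using s0 by (intro inverse_mult_eq_1') simp
  finally show ?thesis by (simp add: s_def)
qed

text \<open>Landen's transformation gives \<open>G = (1 + 4 * s) * dilate G\<close> for the left
  side, and \<open>theta3 ^ 2\<close> satisfies the same equation. The quotient is fixed by
  doubling, hence constant.\<close>

lemma binom_sq_fps_hauptmodul: "binom_sq_fps oo hauptmodul = theta3 ^ 2"
proof -
  define s where "s = sqrt_hauptmodul"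
  define G where "G = binom_sq_fps oo hauptmodul"
  define A where "A = dilate (theta3 ^ 2)"
  have s0: "s $ 0 = 0" by (simp add: s_def)
  have "G = (binom_sq_fps oo (fps_X * inverse (1 + 4 * fps_X) ^ 2)) oo s"
    unfolding G_def hauptmodul_eq_compose s_def by (rule fps_compose_assoc) simp_all
  also have "\<dots> = (1 + 4 * s) * (dilate binom_sq_fps oo s)"
    unfolding binom_sq_fps_landen using s0 by (simp add: fps_compose_mult_distrib fps_compose_add_distrib)
  also have "dilate binom_sq_fps oo s = binom_sq_fps oo (fps_X ^ 2 oo s)"
    unfolding dilate_def by (rule fps_compose_assoc [symmetric]) (use s0 in auto)
  also have "fps_X ^ 2 oo s = dilate hauptmodul"
    using s0 by (simp add: fps_compose_power [symmetric] dilate_hauptmodul s_def)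
  also have "binom_sq_fps oo dilate hauptmodul = dilate G"
    unfolding G_def by (rule dilate_compose [symmetric]) simp
  finally have G: "G = (1 + 4 * s) * dilate G" .
  have a: "theta3 ^ 2 = (1 + 4 * s) * A"
    unfolding A_def s_def by (rule sqrt_hauptmodul_theta [symmetric])
  define r where "r = G * inverse (theta3 ^ 2)"
  have t0: "(theta3 ^ 2) $ 0 \<noteq> 0" by (simp add: fps_power_zeroth)
  have r: "G = r * theta3 ^ 2"
    unfolding r_def using inverse_mult_eq_1 [OF t0] by (simp add: mult.assoc)
  have "r * theta3 ^ 2 = (1 + 4 * s) * dilate (r * theta3 ^ 2)"
    using G unfolding r .
  also have "\<dots> = dilate r * ((1 + 4 * s) * A)"
    by (simp add: A_def mult_ac)
  also have "\<dots> = dilate r * theta3 ^ 2"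
    by (simp only: a)
  finally have "dilate r = r"
    using fps_neq_0I [OF t0] by (metis mult_right_cancel)
  then have "r = fps_const (r $ 0)" by (rule dilate_fixed)
  moreover have "r $ 0 = 1" by (simp add: r_def G_def fps_power_zeroth)
  ultimately show ?thesis using r by (simp add: G_def)
qed

text \<open>Differentiating \<open>t * (1 + 4 * s) ^ 2 = s\<close> and
  \<open>dilate t = s ^ 2\<close> gives a doubling formula for the logarithmic derivative L of t.
  The claimed value K obeys it too, so \<open>L / K\<close> is fixed by doubling.\<close>

lemma XD_hauptmodul: "XD hauptmodul = hauptmodul * ((1 - 16 * hauptmodul) * theta3 ^ 4)"
proof -
  define t where "t = hauptmodul"
  define s where "s = sqrt_hauptmodul"
  define w where "w = inverse hauptmodul_inv"
  \<comment> \<open>As t is q times w, this is \<open>XD t / t\<close> without a division by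
    t.\<close>
  define L where "L = 1 + XD w * inverse w"
  define A where "A = dilate (theta3 ^ 2)"
  have s0: "s $ 0 = 0" by (simp add: s_def)
  have w0: "w $ 0 = 1" by (simp add: w_def)
  have tL: "XD t = t * L"
  proof -
    have "w * inverse w = 1" using w0 by (intro inverse_mult_eq_1') simp
    then show ?thesis
      unfolding t_def hauptmodul_def w_def [symmetric] L_def XD_mult XD_X by algebra
  qed
  have t1: "t $ 1 = 1"
    by (simp add: t_def hauptmodul_def)
  then have t0: "t \<noteq> 0" by auto
  have s2: "dilate t = s ^ 2" unfolding t_def s_def by (rule dilate_hauptmodul)
  have ts: "t * (1 + 4 * s) ^ 2 = s" unfolding t_def s_def by (rule hauptmodul_sqrt)
  with t0 have snz: "s \<noteq> 0" using s0 by (metis fps_zero_nth mult_eq_0_iff ts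
      add.right_neutral mult_zero_right power_one zero_neq_one)
  have "2 * s * XD s = XD (dilate t)" unfolding s2 XD_square ..
  also have "\<dots> = 2 * (s ^ 2 * dilate L)" unfolding XD_dilate tL by (simp add: s2)
  finally have "(2 * s) * XD s = (2 * s) * (s * dilate L)" by (simp add: power2_eq_square mult.assoc)
  then have Ds: "XD s = s * dilate L" using snz by (metis mult_left_cancel mult_eq_0_iff zero_neq_numeral)
  have "XD (t * (1 + 4 * s) ^ 2) = XD s" unfolding ts ..
  then have "t * L * (1 + 4 * s) ^ 2 + t * (2 * (1 + 4 * s) * (4 * (s * dilate L))) = s * dilate L"
    unfolding XD_mult XD_square XD_add tL XD_1 XD_numeral Ds by simp
  then have "(t * (1 + 4 * s) ^ 2) * (L * (1 + 4 * s)) + 8 * (t * (1 + 4 * s) ^ 2) * s * dilate L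
      = (1 + 4 * s) * s * dilate L"
    by algebra
  then have "s * (L * (1 + 4 * s)) = s * (dilate L * (1 - 4 * s))"
    unfolding ts by (simp add: algebra_simps)
  with snz have LL: "L * (1 + 4 * s) = dilate L * (1 - 4 * s)" by simp
  define K where "K = (1 - 16 * t) * theta3 ^ 4"
  have K0: "K $ 0 = 1" by (simp add: K_def t_def fps_power_zeroth)
  define e where "e = L * inverse K"
  have eL: "L = e * K"
    unfolding e_def using inverse_mult_eq_1 [of K] K0 by (simp add: mult.assoc)
  have K: "K = (1 - 16 * t) * (1 + 4 * s) ^ 2 * A ^ 2"
  proof -
    have "theta3 ^ 4 = (theta3 ^ 2) ^ 2" by (simp flip: power_mult)
    also have "\<dots> = ((1 + 4 * s) * A) ^ 2"
      using sqrt_hauptmodul_theta by (simp add: s_def A_def)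
    finally show ?thesis by (simp add: K_def power_mult_distrib mult.assoc)
  qed
  have dK: "dilate K = (1 - 16 * s ^ 2) * A ^ 2"
    by (simp add: K_def A_def s2 flip: power_mult)
  have "e * ((1 - 4 * s) ^ 2 * (1 + 4 * s) * A ^ 2) = dilate e * ((1 - 4 * s) ^ 2 * (1 + 4 * s) * A ^ 2)"
  proof -
    have "e * K * (1 + 4 * s) = dilate e * dilate K * (1 - 4 * s)"
      using LL unfolding eL by simp
    moreover have "(1 - 16 * t) * (1 + 4 * s) ^ 2 = (1 - 4 * s) ^ 2"
    proof -
      have "(1 - 16 * t) * (1 + 4 * s) ^ 2 = (1 + 4 * s) ^ 2 - 16 * (t * (1 + 4 * s) ^ 2)"
        by (simp add: algebra_simps)
      also have "\<dots> = (1 - 4 * s) ^ 2"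
        unfolding ts by (simp add: power2_eq_square algebra_simps)
      finally show ?thesis .
    qed
    ultimately show ?thesis unfolding dK unfolding K by algebra
  qed
  moreover have "((1 - 4 * s) ^ 2 * (1 + 4 * s) * A ^ 2) $ 0 \<noteq> 0"
    using s0 by (simp add: fps_power_zeroth A_def)
  ultimately have "dilate e = e"
    using fps_neq_0I by (metis mult_right_cancel)
  then have "e = fps_const (e $ 0)" by (rule dilate_fixed)
  moreover have "e $ 0 = 1" using K0 w0 by (simp add: e_def L_def)
  ultimately have "L = K" using eL by simp
  then show ?thesis using tL by (simp add: K_def t_def)
qed

lemma one_minus_hauptmodul: "(1 - 16 * hauptmodul) * theta3 ^ 4 = theta4 ^ 4"
  using hauptmodul_theta by (simp add: algebra_simps)

lemma XD_hauptmodul': "XD hauptmodul = theta4 ^ 4 * hauptmodul"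
  unfolding XD_hauptmodul one_minus_hauptmodul by (rule mult.commute)

text \<open>The derivative of t combined with its product form; as differentials,
  \<open>eta(2z)^12 dq/q = theta3^8 dt = F(t)^4 dt\<close>.\<close>

lemma eta_prod_eq: "eta_prod = fps_deriv hauptmodul * theta3 ^ 8"
proof -
  have "fps_X * eta_prod = XD hauptmodul * theta3 ^ 8"
    unfolding XD_hauptmodul' hauptmodul_eta [symmetric] by (simp add: mult_ac)
  then have "fps_X * eta_prod = fps_X * (fps_deriv hauptmodul * theta3 ^ 8)"
    by (simp add: XD_eq mult_ac)
  then show ?thesis by simp
qed

lemma XD_power: "XD (f ^ n) = of_nat n * f ^ (n - 1) * XD f"
  by (simp add: XD_eq fps_deriv_power fps_of_nat mult_ac)

text \<open>The logarithmic derivatives of t and \<open>q / t\<close> add up to that of q, which is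
  1.\<close>

lemma XD_hauptmodul_inv: "XD hauptmodul_inv = hauptmodul_inv * (1 - theta4 ^ 4)"
proof -
  have "hauptmodul \<noteq> 0" using hauptmodul_mult_inv by (metis fps_X_neq_zero mult_zero_left)
  moreover have "XD (hauptmodul * hauptmodul_inv) = hauptmodul * hauptmodul_inv"
    unfolding hauptmodul_mult_inv by simp
  then have "hauptmodul * XD hauptmodul_inv = hauptmodul * (hauptmodul_inv * (1 - theta4 ^ 4))"
    unfolding XD_mult XD_hauptmodul' by (simp add: algebra_simps)
  ultimately show ?thesis by (metis mult_left_cancel)
qed

text \<open>The residue of \<open>H(t) dt / t\<^sup>N\<^sup>+\<^sup>1\<close> does not depend on the variable; here \<open>t = X / v\<close>.\<close>

lemma lagrange_residue:
  fixes t v H :: "rat fps"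
  assumes tv: "t * v = fps_X" and t0: "t $ 0 = 0"
  shows "((H oo t) * (fps_deriv t * v ^ Suc N)) $ N = H $ N"
proof -
  have der: "fps_deriv t * v + t * fps_deriv v = 1"
    using arg_cong [OF tv, of fps_deriv] by (simp add: mult.commute add.commute)
  \<comment> \<open>The case \<open>H = 1\<close>: for \<open>n > 0\<close> the differential
    \<open>dt / t^(n+1)\<close> is exact and has no residue.\<close>
  have unit: "(fps_deriv t * v ^ Suc n) $ n = (if n = 0 then 1 else 0)" for n
  proof (cases n)
    case 0
    then show ?thesis using arg_cong [OF der, of "\<lambda>f. f $ 0"] t0 by simp
  next
    case (Suc m)
    have "fps_deriv t * v * v + t * v * fps_deriv v = v"
      using arg_cong [OF der, of "\<lambda>f. f * v"] by (simp add: algebra_simps)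
    then have 1: "fps_deriv t * v * v = v - XD v" unfolding tv XD_eq by (simp add: algebra_simps)
    have "of_nat n * (fps_deriv t * v ^ Suc n) = of_nat n * ((fps_deriv t * v * v) * v ^ m)"
      by (simp add: Suc mult_ac)
    also have "\<dots> = of_nat n * v ^ n - XD (v ^ n)"
      unfolding 1 XD_power by (simp add: Suc algebra_simps)
    finally have "(of_nat n * (fps_deriv t * v ^ Suc n)) $ n = (of_nat n * v ^ n - XD (v ^ n)) $ n"
      by simp
    then have "of_nat n * (fps_deriv t * v ^ Suc n) $ n = 0"
      by (simp add: fps_of_nat [symmetric])
    then show ?thesis using Suc by simp
  qed
  have summand: "(t ^ i * (fps_deriv t * v ^ Suc N)) $ N = (if i = N then 1 else 0)" if "i \<le> N" for i
  proof -
    have "Suc N = i + Suc (N - i)" using that by simp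
    then have "t ^ i * (fps_deriv t * v ^ Suc N) = (t * v) ^ i * (fps_deriv t * v ^ Suc (N - i))"
      by (metis (no_types, lifting) mult.assoc mult.left_commute power_add power_mult_distrib)
    then have "(t ^ i * (fps_deriv t * v ^ Suc N)) $ N = (fps_deriv t * v ^ Suc (N - i)) $ (N - i)"
      using that by (simp only: tv fps_X_power_mult_nth) simp
    then show ?thesis using that by (simp only: unit) auto
  qed
  \<comment> \<open>Powers of t beyond N do not reach degree N, so H may be truncated.\<close>
  define T where "T = (\<Sum>i=0..N. fps_const (H $ i) * t ^ i)"
  have "(H oo t) $ j = T $ j" if "j \<le> N" for j
  proof -
    have "t ^ i $ j = 0" if "j < i" for i
      using t0 that by (simp add: startsby_zero_power_prefix)
    then have "(\<Sum>i=0..N. H $ i * t ^ i $ j) = (\<Sum>i=0..j. H $ i * t ^ i $ j)"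
      using \<open>j \<le> N\<close> by (intro sum.mono_neutral_right) auto
    then show ?thesis by (simp add: T_def fps_compose_nth fps_sum_nth)
  qed
  then have "((H oo t) * (fps_deriv t * v ^ Suc N)) $ N = (T * (fps_deriv t * v ^ Suc N)) $ N"
    unfolding fps_mult_nth [of _ _ N] by (intro sum.cong) auto
  also have "\<dots> = (\<Sum>i=0..N. H $ i * (t ^ i * (fps_deriv t * v ^ Suc N)) $ N)"
    by (simp add: T_def sum_distrib_right fps_sum_nth mult.assoc del: power_Suc)
  also have "\<dots> = (\<Sum>i=0..N. if i = N then H $ i else 0)"
    by (intro sum.cong) (auto simp: summand simp del: power_Suc)
  finally show ?thesis by simp
qed

section \<open>Power series whose initial coefficients are divisible by an integer\<close>

text \<open>Applied to \<open>f - g\<close>, this is congruence modulo \<open>m\<close> and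
  \<open>X ^ N\<close>; \<open>m = 1\<close> expresses integrality.\<close>

definition mult_upto :: "nat \<Rightarrow> int \<Rightarrow> rat fps \<Rightarrow> bool" where
  "mult_upto N m f \<longleftrightarrow> (\<forall>n<N. \<exists>z. f $ n = of_int (m * z))"

lemma mult_uptoI: "(\<And>n. n < N \<Longrightarrow> \<exists>z. f $ n = of_int (m * z)) \<Longrightarrow> mult_upto N m f"
  by (simp add: mult_upto_def)

lemma mult_upto_add:
  assumes "mult_upto N m f" "mult_upto N m g"
  shows "mult_upto N m (f + g)"
proof (rule mult_uptoI)
  fix n assume "n < N"
  with assms obtain x y where "f $ n = of_int (m * x)" "g $ n = of_int (m * y)"
    unfolding mult_upto_def by meson
  then show "\<exists>z. (f + g) $ n = of_int (m * z)"
    by (intro exI [of _ "x + y"]) (simp add: algebra_simps)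
qed

lemma mult_upto_uminus: "mult_upto N m f \<Longrightarrow> mult_upto N m (- f)"
  unfolding mult_upto_def by (metis fps_neg_nth mult_minus_right of_int_minus)

lemma mult_upto_diff: "mult_upto N m f \<Longrightarrow> mult_upto N m g \<Longrightarrow> mult_upto N m (f - g)"
  using mult_upto_add [of N m f "- g"] mult_upto_uminus [of N m g] by simp

lemma rat_sum_multiples:
  assumes "\<And>i. i \<in> A \<Longrightarrow> \<exists>z. f i = rat_of_int (m * z)"
  shows "\<exists>z. sum f A = of_int (m * z)"
proof -
  from assms obtain z where "\<And>i. i \<in> A \<Longrightarrow> f i = of_int (m * z i)" by metis
  then have "sum f A = of_int (m * sum z A)" by (simp add: sum_distrib_left)
  then show ?thesis ..
qed

lemma mult_upto_mult:
  assumes "mult_upto N m f" "mult_upto N l g"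
  shows "mult_upto N (m * l) (f * g)"
proof (rule mult_uptoI)
  fix n assume "n < N"
  show "\<exists>z. (f * g) $ n = of_int ((m * l) * z)"
    unfolding fps_mult_nth
  proof (rule rat_sum_multiples)
    fix i assume "i \<in> {0..n}"
    then have "i < N" "n - i < N" using \<open>n < N\<close> by auto
    with assms obtain x y where "f $ i = of_int (m * x)" "g $ (n - i) = of_int (l * y)"
      unfolding mult_upto_def by meson
    then show "\<exists>z. f $ i * g $ (n - i) = of_int ((m * l) * z)"
      by (intro exI [of _ "x * y"]) (simp add: algebra_simps)
  qed
qed

lemma mult_upto_mult_left: "mult_upto N 1 f \<Longrightarrow> mult_upto N m g \<Longrightarrow> mult_upto N m (f * g)"
  using mult_upto_mult [of N 1 f m g] by simp

lemma mult_upto_of_int: "mult_upto N m (of_int m)"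
proof (rule mult_uptoI)
  fix n show "\<exists>z. (of_int m :: rat fps) $ n = of_int (m * z)"
    by (rule exI [of _ "if n = 0 then 1 else 0"]) (simp add: fps_of_int [symmetric])
qed

lemma mult_upto_scale: "mult_upto N l f \<Longrightarrow> mult_upto N (m * l) (of_int m * f)"
  by (intro mult_upto_mult mult_upto_of_int)

lemma mult_upto_1 [simp]: "mult_upto N 1 1" "mult_upto N 1 (numeral k)" "mult_upto N 1 fps_X"
  "mult_upto N 1 (of_int j)"
proof -
  show j: "mult_upto N 1 (of_int j)" for j
    using mult_upto_of_int [of N j] by (auto simp: mult_upto_def)
  show "mult_upto N 1 1" "mult_upto N 1 (numeral k)"
    using j [of 1] j [of "numeral k"] by simp_all
  show "mult_upto N 1 fps_X"
    by (rule mult_uptoI) (auto simp: fps_X_def intro: exI [of _ 0] exI [of _ 1])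
qed

lemma mult_upto_power: "mult_upto N 1 f \<Longrightarrow> mult_upto N 1 (f ^ k)"
  by (induction k) (auto intro: mult_upto_mult_left)

lemma mult_upto_compose:
  assumes "mult_upto N m f" "mult_upto N 1 g"
  shows "mult_upto N m (f oo g)"
proof (rule mult_uptoI)
  fix n assume "n < N"
  show "\<exists>z. (f oo g) $ n = of_int (m * z)"
    unfolding fps_compose_nth
  proof (rule rat_sum_multiples)
    fix i assume "i \<in> {0..n}"
    then have "i < N" using \<open>n < N\<close> by auto
    with assms(1) obtain x where x: "f $ i = of_int (m * x)"
      unfolding mult_upto_def by meson
    obtain y where "(g ^ i) $ n = of_int (1 * y)"
      using mult_upto_power [OF assms(2), of i] \<open>n < N\<close> unfolding mult_upto_def by meson
    with x show "\<exists>z. f $ i * (g ^ i) $ n = of_int (m * z)"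
      by (intro exI [of _ "x * y"]) (simp add: algebra_simps)
  qed
qed

lemma mult_upto_inverse:
  assumes "mult_upto N 1 f" "f $ 0 = 1"
  shows "mult_upto N 1 (inverse f)"
proof (rule mult_uptoI)
  fix n
  show "n < N \<Longrightarrow> \<exists>z. inverse f $ n = of_int (1 * z)"
  proof (induction n rule: less_induct)
    case (less n)
    show ?case
    proof (cases "n = 0")
      case True
      then show ?thesis using assms by (auto intro: exI [of _ 1])
    next
      case False
      have "\<exists>z. (\<Sum>i=1..n. f $ i * inverse f $ (n - i)) = of_int (1 * z)"
      proof (rule rat_sum_multiples)
        fix i assume i: "i \<in> {1..n}"
        obtain x where x: "f $ i = of_int x"
          using assms(1) i less.prems unfolding mult_upto_def by fastforce
        obtain y where "inverse f $ (n - i) = of_int y"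
          using less.IH [of "n - i"] i less.prems by auto
        with x show "\<exists>z. f $ i * inverse f $ (n - i) = of_int (1 * z)"
          by (intro exI [of _ "x * y"]) simp
      qed
      then obtain z where "(\<Sum>i=1..n. f $ i * inverse f $ (n - i)) = of_int z" by auto
      moreover have "inverse f $ n = - (\<Sum>i=1..n. f $ i * inverse f $ (n - i))"
        using False assms(2) by (cases n) (simp_all add: fps_inverse_def)
      ultimately show ?thesis by (intro exI [of _ "- z"]) simp
    qed
  qed
qed

lemma mult_upto_XD: "mult_upto N m f \<Longrightarrow> mult_upto N m (XD f)"
proof (rule mult_uptoI)
  fix n assume "n < N" "mult_upto N m f"
  then obtain x where "f $ n = of_int (m * x)" unfolding mult_upto_def by meson
  then show "\<exists>z. XD f $ n = of_int (m * z)"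
    by (intro exI [of _ "of_nat n * x"]) (simp add: algebra_simps)
qed

lemma mult_upto_deriv: "mult_upto (Suc N) m f \<Longrightarrow> mult_upto N m (fps_deriv f)"
proof (rule mult_uptoI)
  fix n assume "n < N" "mult_upto (Suc N) m f"
  then obtain x where "f $ Suc n = of_int (m * x)" unfolding mult_upto_def by (meson Suc_less_eq)
  then show "\<exists>z. fps_deriv f $ n = of_int (m * z)"
    by (intro exI [of _ "of_nat (Suc n) * x"]) (simp add: algebra_simps)
qed

text \<open>Indices \<open>0 < n < p\<close> are prime to p, so dividing \<open>n * f $ n\<close> by
  n keeps the power of p.\<close>

lemma mult_upto_integrate:
  assumes "prime p" "mult_upto p 1 f" "mult_upto p (int p ^ k) (XD f)"
  shows "mult_upto p (int p ^ k) (f - fps_const (f $ 0))"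
proof (rule mult_uptoI)
  fix n assume n: "n < p"
  show "\<exists>z. (f - fps_const (f $ 0)) $ n = of_int (int p ^ k * z)"
  proof (cases "n = 0")
    case False
    obtain x where x: "f $ n = of_int x"
      using assms(2) n unfolding mult_upto_def by fastforce
    obtain y where "XD f $ n = of_int (int p ^ k * y)"
      using assms(3) n unfolding mult_upto_def by meson
    then have "rat_of_int (int n * x) = of_int (int p ^ k * y)" using x by simp
    then have "int n * x = int p ^ k * y" by (simp only: of_int_eq_iff)
    then have "int p ^ k dvd int n * x" by simp
    moreover have "coprime (int p ^ k) (int n)"
    proof -
      have "\<not> p dvd n" using False n by (auto dest: dvd_imp_le)
      then have "coprime p n" using assms(1) by (simp add: prime_imp_coprime)
      then show ?thesis by simp
    qed
    ultimately have "int p ^ k dvd x" by (simp add: coprime_dvd_mult_right_iff)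
    then show ?thesis using x False by (auto elim!: dvdE)
  qed (auto intro: exI [of _ 0])
qed

section \<open>Integrality of the modular series\<close>

lemma mult_upto_theta [simp]: "mult_upto N 1 theta3" "mult_upto N 1 theta4"
proof -
  show "mult_upto N 1 theta3"
    by (rule mult_uptoI) (auto simp: theta3_def intro: exI [of _ "int _"])
  show "mult_upto N 1 theta4"
    by (rule mult_uptoI) (auto simp: theta4_def intro: exI [of _ "(-1) ^ _ * int _"])
qed

lemma mult_upto_eta_prod [simp]: "mult_upto N 1 eta_prod"
proof -
  have "mult_upto N 1 (euler_poly n)" for n N
    by (induction n) (auto simp: euler_poly_Suc intro!: mult_upto_mult_left mult_upto_diff mult_upto_power simp del: power_Suc)
  then have "mult_upto N 1 euler" for N
    unfolding mult_upto_def euler_def by (metis fps_nth_Abs_fps lessI)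
  then have "mult_upto N 1 (dilate euler)"
    unfolding dilate_def by (intro mult_upto_compose mult_upto_power) auto
  then show ?thesis unfolding eta_prod_def by (rule mult_upto_power)
qed

lemma mult_upto_hauptmodul [simp]: "mult_upto N 1 hauptmodul_inv" "mult_upto N 1 hauptmodul"
proof -
  show inv: "mult_upto N 1 hauptmodul_inv"
    unfolding hauptmodul_inv_def
    by (intro mult_upto_mult_left mult_upto_power mult_upto_inverse) auto
  then show "mult_upto N 1 hauptmodul"
    unfolding hauptmodul_def by (intro mult_upto_mult_left mult_upto_inverse) auto
qed

lemma mult_upto_binom_sq_fps [simp]: "mult_upto N 1 binom_sq_fps"
  by (rule mult_uptoI) (auto simp: binom_sq_fps_def intro: exI [of _ "int _ ^ 2"])

section \<open>Binomial congruences\<close>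

lemma prime_cong_cancel:
  fixes a b c :: int
  assumes "prime p" "\<not> int p dvd c" "[c * a = c * b] (mod int p ^ k)"
  shows "[a = b] (mod int p ^ k)"
proof -
  have "coprime c (int p)"
    using assms(1,2) by (metis coprime_commute prime_imp_coprime prime_nat_int_transfer)
  then show ?thesis
    using assms(3) by (simp add: cong_mult_lcancel)
qed

lemma prime_not_dvd_nat_square:
  assumes "prime p" "0 < n" "n < p"
  shows "\<not> int p dvd int n ^ 2"
proof -
  have "\<not> p dvd n" using assms by (auto dest: dvd_imp_le)
  then show ?thesis using assms(1) by (metis int_dvd_int_iff prime_dvd_power prime_nat_int_transfer)
qed

lemma prime_not_dvd_power2:
  assumes "prime p" "odd p"
  shows "\<not> int p dvd 2 ^ k"
proof
  assume "int p dvd 2 ^ k"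
  then have "int p dvd 2" using assms(1) by (metis prime_dvd_power prime_nat_int_transfer)
  then have "p dvd 2" by (metis int_dvd_int_iff of_nat_numeral)
  then show False using assms by (metis prime_nat_iff two_is_prime_nat dvd_refl even_numeral not_prime_unit primes_dvd_imp_eq)
qed

lemma central_binomial_sq_Suc:
  "int (Suc n) ^ 2 * int (2 * Suc n choose Suc n) ^ 2 = 4 * (2 * int n + 1) ^ 2 * int (2 * n choose n) ^ 2"
proof -
  have "int (Suc n * (2 * Suc n choose Suc n)) ^ 2 = int (2 * (2 * n + 1) * (2 * n choose n)) ^ 2"
    by (simp only: central_binomial_Suc)
  then show ?thesis
    unfolding of_nat_mult power_mult_distrib by simp
qed

lemma binom_term_Suc: "int (Suc k) ^ 2 * binom_term h (Suc k) = (int h - int k) * (int h + int k + 1) * binom_term h k"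
proof -
  have 1: "int (Suc k) * int (h choose Suc k) = (int h - int k) * int (h choose k)"
  proof (cases "k \<le> h")
    case True
    have "Suc k * (h choose Suc k) = (h - k) * (h choose k)"
      by (metis binomial_absorption diff_Suc_1 binomial_absorb_comp)
    then have "int (Suc k * (h choose Suc k)) = int ((h - k) * (h choose k))" by simp
    then show ?thesis using True by (simp only: of_nat_mult of_nat_diff)
  qed (simp add: binomial_eq_0)
  have "Suc (h + k) * (h + k choose k) = (Suc (h + k) choose Suc k) * Suc k"
    by (rule Suc_times_binomial_eq)
  then have "int (Suc (h + k) * (h + k choose k)) = int ((Suc (h + k) choose Suc k) * Suc k)"
    by simp
  then have 2: "int (Suc k) * int (h + Suc k choose Suc k) = (int h + int k + 1) * int (h + k choose k)"
    by (simp add: algebra_simps)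
  have "int (Suc k) ^ 2 * binom_term h (Suc k)
      = (int (Suc k) * int (h choose Suc k)) * (int (Suc k) * int (h + Suc k choose Suc k))"
    by (simp add: binom_term_def power2_eq_square)
  then show ?thesis unfolding 1 2 by (simp add: binom_term_def)
qed

text \<open>The factor in \<open>binom_term_Suc\<close> is \<open>(p^2 - (2k + 1)^2) / 4\<close>, so
  modulo \<open>p ^ 2\<close> both sides obey the same recursion. For \<open>h < k < p\<close> the
  left side is 0, so the squared central binomial is divisible by \<open>p ^ 2\<close>.\<close>

lemma binom_term_cong:
  assumes "prime p" "p = 2 * h + 1" "k < p"
  shows "[16 ^ k * binom_term h k = (-1) ^ k * int (2 * k choose k) ^ 2] (mod int p ^ 2)"
  using assms(3)
proof (induction k)
  case (Suc k)
  define a where "a = 16 ^ k * binom_term h k"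
  define b where "b = (-1) ^ k * int (2 * k choose k) ^ 2"
  have ab: "[a = b] (mod int p ^ 2)" using Suc unfolding a_def b_def by simp
  have "int (Suc k) ^ 2 * (16 ^ Suc k * binom_term h (Suc k))
      = 16 * 16 ^ k * (int (Suc k) ^ 2 * binom_term h (Suc k))" by simp
  also have "\<dots> = 4 * (int p ^ 2 - (2 * int k + 1) ^ 2) * a"
    unfolding binom_term_Suc a_def assms(2) by (simp add: power2_eq_square algebra_simps)
  finally have l: "int (Suc k) ^ 2 * (16 ^ Suc k * binom_term h (Suc k))
      = 4 * (int p ^ 2 - (2 * int k + 1) ^ 2) * a" .
  have "int (Suc k) ^ 2 * ((-1) ^ Suc k * int (2 * Suc k choose Suc k) ^ 2)
      = - ((-1) ^ k * (int (Suc k) ^ 2 * int (2 * Suc k choose Suc k) ^ 2))" by simp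
  also have "\<dots> = - 4 * (2 * int k + 1) ^ 2 * b"
    unfolding central_binomial_sq_Suc b_def by simp
  finally have r: "int (Suc k) ^ 2 * ((-1) ^ Suc k * int (2 * Suc k choose Suc k) ^ 2)
      = - 4 * (2 * int k + 1) ^ 2 * b" .
  have "[4 * (int p ^ 2 - (2 * int k + 1) ^ 2) * a = - 4 * (2 * int k + 1) ^ 2 * a] (mod int p ^ 2)"
    by (simp add: cong_iff_dvd_diff algebra_simps)
  also have "[- 4 * (2 * int k + 1) ^ 2 * a = - 4 * (2 * int k + 1) ^ 2 * b] (mod int p ^ 2)"
    by (intro cong_mult ab cong_refl)
  finally show ?case
    unfolding l [symmetric] r [symmetric]
    by (rule prime_cong_cancel [OF assms(1) prime_not_dvd_nat_square [OF assms(1)], rotated 2])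
      (use Suc in auto)
qed (simp add: binom_term_def)

text \<open>As \<open>binom_term h h\<close> is the central binomial itself,
  \<open>binom_term_cong\<close> at h relates it to its own square, and one factor prime to p
  cancels.\<close>

lemma central_binomial_cong:
  assumes "prime p" "p = 2 * h + 1"
  shows "[int (2 * h choose h) = (-1) ^ h * 16 ^ h] (mod int p ^ 2)"
    and "\<not> int p dvd int (2 * h choose h)"
proof -
  define B where "B = 2 * h choose h"
  show nd: "\<not> int p dvd int (2 * h choose h)"
  proof
    assume "int p dvd int (2 * h choose h)"
    then have "p dvd (2 * h choose h)" by simp
    moreover have "(2 * h choose h) dvd fact (2 * h)"
      using binomial_fact_lemma [of h "2 * h"] by (metis dvd_triv_right le_add1 mult_2)
    ultimately have "p dvd fact (2 * h)" by (rule dvd_trans)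
    then show False using assms by (simp add: prime_dvd_fact_iff)
  qed
  have sgn: "(-1) ^ h * ((-1) ^ h * z) = (z :: int)" for z
    by (cases "even h") auto
  have "binom_term h h = int B"
    by (simp add: binom_term_def B_def mult_2)
  then have "[16 ^ h * int B = (-1) ^ h * int B ^ 2] (mod int p ^ 2)"
    using binom_term_cong [OF assms, of h] assms(2) by (simp add: B_def)
  then have "[(-1) ^ h * (16 ^ h * int B) = (-1) ^ h * ((-1) ^ h * int B ^ 2)] (mod int p ^ 2)"
    by (rule cong_scalar_left)
  then have "[int B * ((-1) ^ h * 16 ^ h) = int B * int B] (mod int p ^ 2)"
    unfolding sgn by (simp add: power2_eq_square mult_ac)
  then have "[(-1) ^ h * 16 ^ h = int B] (mod int p ^ 2)"
    by (rule prime_cong_cancel [OF assms(1) nd [folded B_def]])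
  then show "[int (2 * h choose h) = (-1) ^ h * 16 ^ h] (mod int p ^ 2)"
    unfolding B_def by (rule cong_sym)
qed

text \<open>Coefficients of the Frobenius deformation of \<^const>\<open>binom_sq_fps\<close> with exponent \<open>-p/2\<close>,
  scaled to be integral: up to the factor \<open>binom(2h, h)\<^sup>2\<close>, the \<open>k\<close>-th one is
  \<open>16\<^sup>k ((1/2 - p/2)\<^sub>k / (1 - p/2)\<^sub>k)\<^sup>2\<close> (Pochhammer symbols), where \<open>p = 2h + 1\<close>.\<close>

definition deform_coeff :: "nat \<Rightarrow> nat \<Rightarrow> int" where
  "deform_coeff h k = (if k \<le> h then 256 ^ k * int (2 * (h - k) choose (h - k)) ^ 2 else 0)"

text \<open>At \<open>k = h\<close> the factor \<open>(h - k)^2\<close> vanishes, so the recursion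
  survives the cut-off and the deformed solution is a polynomial.\<close>

lemma deform_coeff_Suc:
  "(2 * int h - 2 * int k - 1) ^ 2 * deform_coeff h (Suc k) = 64 * (int h - int k) ^ 2 * deform_coeff h k"
proof (cases "k < h")
  case True
  then obtain n where n: "h = k + Suc n" using less_imp_Suc_add by fastforce
  have "(2 * int n + 1) ^ 2 * (256 * 256 ^ k * int (2 * n choose n) ^ 2)
    = 64 * 256 ^ k * (4 * (2 * int n + 1) ^ 2 * int (2 * n choose n) ^ 2)"
    by simp
  then show ?thesis
    unfolding central_binomial_sq_Suc [symmetric] n deform_coeff_def by (simp add: algebra_simps)
qed (auto simp: deform_coeff_def)

text \<open>Modulo p, the factors \<open>2h - 2k - 1 = p - 2(k + 1)\<close> and
  \<open>2(h - k) = p - (2k + 1)\<close> lose their p, which leaves the recursion of the squared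
  central binomials.\<close>

lemma deform_coeff_cong:
  assumes "prime p" "p = 2 * h + 1" "k < p"
  shows "[deform_coeff h k = int (2 * h choose h) ^ 2 * int (2 * k choose k) ^ 2] (mod int p)"
  using assms(3)
proof (induction k)
  case (Suc k)
  define a where "a = deform_coeff h k"
  define b where "b = int (2 * h choose h) ^ 2 * int (2 * k choose k) ^ 2"
  have ab: "[a = b] (mod int p)" using Suc unfolding a_def b_def by simp
  have "[4 * int (Suc k) ^ 2 = (2 * int h - 2 * int k - 1) ^ 2] (mod int p)"
  proof -
    have "4 * int (Suc k) ^ 2 - (2 * int h - 2 * int k - 1) ^ 2 = int p * (4 * int k + 4 - int p)"
      unfolding assms(2) by (simp add: power2_eq_square algebra_simps)
    then show ?thesis by (simp add: cong_iff_dvd_diff)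
  qed
  then have "[4 * int (Suc k) ^ 2 * deform_coeff h (Suc k)
      = (2 * int h - 2 * int k - 1) ^ 2 * deform_coeff h (Suc k)] (mod int p)"
    by (rule cong_scalar_right)
  also have "(2 * int h - 2 * int k - 1) ^ 2 * deform_coeff h (Suc k) = 64 * (int h - int k) ^ 2 * a"
    unfolding a_def by (rule deform_coeff_Suc)
  also have "[64 * (int h - int k) ^ 2 * a = 16 * (2 * int k + 1) ^ 2 * b] (mod int p)"
  proof (rule cong_mult [OF _ ab])
    have "64 * (int h - int k) ^ 2 - 16 * (2 * int k + 1) ^ 2 = int p * (16 * (2 * int h - 4 * int k - 1))"
      unfolding assms(2) by (simp add: power2_eq_square algebra_simps)
    then show "[64 * (int h - int k) ^ 2 = 16 * (2 * int k + 1) ^ 2] (mod int p)"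
      by (simp add: cong_iff_dvd_diff)
  qed
  also have "16 * (2 * int k + 1) ^ 2 * b
      = 4 * int (Suc k) ^ 2 * (int (2 * h choose h) ^ 2 * int (2 * Suc k choose Suc k) ^ 2)"
    unfolding b_def using central_binomial_sq_Suc [of k] by algebra
  finally have "[4 * int (Suc k) ^ 2 * deform_coeff h (Suc k)
      = 4 * int (Suc k) ^ 2 * (int (2 * h choose h) ^ 2 * int (2 * Suc k choose Suc k) ^ 2)] (mod int p ^ 1)"
    by simp
  moreover have "\<not> int p dvd 4 * int (Suc k) ^ 2"
  proof
    assume "int p dvd 4 * int (Suc k) ^ 2"
    then have "int p dvd 2 ^ 2 \<or> int p dvd int (Suc k) ^ 2"
      using assms(1) by (metis prime_dvd_mult_iff prime_nat_int_transfer four_x_squared numeral_Bit0_eq_double power2_eq_square mult_2)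
    then show False
      using prime_not_dvd_power2 [of p 2] prime_not_dvd_nat_square [of p "Suc k"] assms(1,2) Suc.prems
      by auto
  qed
  ultimately show ?case
    using prime_cong_cancel [OF assms(1)] by (metis power_one_right)
qed (simp add: deform_coeff_def)

section \<open>Frobenius deformation\<close>

definition deform_fps :: "nat \<Rightarrow> rat fps" where
  "deform_fps h = Abs_fps (\<lambda>k. of_int (deform_coeff h k))"

lemma of_int_mult_nth: "(of_int m * f) $ n = of_int m * (f :: rat fps) $ n"
  by (simp add: fps_of_int [symmetric])

lemma of_int_nth: "(of_int m :: rat fps) $ n = (if n = 0 then of_int m else 0)"
  by (simp add: fps_of_int [symmetric])

lemma XD_of_int [simp]: "XD (of_int m) = 0"
  by (simp add: fps_eq_iff of_int_nth)

lemma mult_upto_deform_fps [simp]: "mult_upto N 1 (deform_fps h)"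
  by (rule mult_uptoI) (auto simp: deform_fps_def)

text \<open>The equation \<open>(2 XD)^2 Y = 16 X (2 XD + 1)^2 Y\<close> with \<open>2 XD\<close>
  replaced by \<open>2 XD - p\<close>, sorted by powers of p. The shifted operator does not
  annihilate the constant term of Y, whence the last summand.\<close>

lemma deform_fps_ode:
  assumes "p = 2 * h + 1"
  shows "4 * ((1 - 16 * fps_X) * XD (XD (deform_fps h)))
    = 64 * fps_X * XD (deform_fps h) + 16 * fps_X * deform_fps h
      + of_int (4 * int p) * ((1 - 16 * fps_X) * XD (deform_fps h))
      - of_int (int p) * (32 * fps_X * deform_fps h)
      + of_int (int p ^ 2) * (16 * fps_X * deform_fps h - deform_fps h + of_int (deform_coeff h 0))"
    (is "?l = ?r")
proof (rule fps_ext)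
  fix n
  have four: "(4 * f) $ n = 4 * f $ n" for f :: "rat fps" and n
    by (simp add: numeral_fps_const)
  show "?l $ n = ?r $ n"
  proof (cases n)
    case 0
    then show ?thesis
      unfolding left_diff_distrib of_int_mult_nth fps_add_nth fps_sub_nth four by (simp add: of_int_nth deform_fps_def)
  next
    case (Suc k)
    define y0 where "y0 = rat_of_int (deform_coeff h k)"
    define y1 where "y1 = rat_of_int (deform_coeff h (Suc k))"
    define K where "K = rat_of_nat k"
    define Q where "Q = rat_of_int (int p)"
    have Q: "Q = 2 * of_nat h + 1" by (simp add: Q_def assms)
    have "rat_of_int ((2 * int h - 2 * int k - 1) ^ 2 * deform_coeff h (Suc k))
        = of_int (64 * (int h - int k) ^ 2 * deform_coeff h k)"
      by (simp only: deform_coeff_Suc)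
    then have rec: "(Q - 2 * K - 2) ^ 2 * y1 = 16 * (Q - 2 * K - 1) ^ 2 * y0"
      unfolding Q K_def y0_def y1_def by (simp add: power2_eq_square algebra_simps)
    have nth: "deform_fps h $ k = y0" "deform_fps h $ Suc k = y1" "rat_of_nat (Suc k) = K + 1"
      by (simp_all add: deform_fps_def y0_def y1_def K_def)
    show ?thesis
      unfolding Suc left_diff_distrib of_int_mult_nth fps_add_nth fps_sub_nth four numeral_X_mult_nth_Suc
        mult_1_left fps_XD_nth nth of_int_nth K_def [symmetric]
      unfolding of_int_mult of_int_power of_int_numeral Q_def [symmetric]
      using rec by (simp add: power2_eq_square algebra_simps)
  qed
qed

lemma deform_fps_cong:
  assumes "prime p" "p = 2 * h + 1"
  shows "mult_upto p (int p) (deform_fps h - of_int (deform_coeff h 0) * binom_sq_fps)"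
proof (rule mult_uptoI)
  fix n assume "n < p"
  from deform_coeff_cong [OF assms this]
  obtain z where z: "deform_coeff h n - deform_coeff h 0 * int (2 * n choose n) ^ 2 = int p * z"
    by (auto simp: cong_iff_dvd_diff deform_coeff_def elim!: dvdE)
  have "(deform_fps h - of_int (deform_coeff h 0) * binom_sq_fps) $ n
      = of_int (deform_coeff h n - deform_coeff h 0 * int (2 * n choose n) ^ 2)"
    by (simp add: of_int_mult_nth deform_fps_def binom_sq_fps_def)
  then show "\<exists>z. (deform_fps h - of_int (deform_coeff h 0) * binom_sq_fps) $ n = of_int (int p * z)"
    unfolding z by blast
qed

text \<open>For solutions of the undeformed equation, \<open>1 - 16x\<close> times the Wronskian is
  constant. Here its derivative is, modulo \<open>p ^ 2\<close>, p times an expression linear in Y;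
  replacing Y by \<open>c * F\<close> there turns it into an exact derivative, which is integrated
  below degree p.\<close>

lemma wronskian_cong:
  assumes "prime p" "p = 2 * h + 1"
  defines "Y \<equiv> deform_fps h" and "F \<equiv> binom_sq_fps" and "c \<equiv> of_int (deform_coeff h 0)"
  shows "mult_upto p (int p ^ 2)
    (4 * ((1 - 16 * fps_X) * (F * XD Y - Y * XD F))
      - of_int (int p) * (2 * c * ((1 - 16 * fps_X) * F ^ 2 - 1)))"
proof -
  define V where "V = (1 - 16 * fps_X) * (F * XD Y - Y * XD F)"
  define P where "P = (of_int (int p) :: rat fps)"
  define d where "d = Y - c * F"
  define R where "R = 16 * fps_X * Y - Y + c"
  define \<Delta> where "\<Delta> = 4 * V - P * (2 * c * ((1 - 16 * fps_X) * F ^ 2))"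
  have iF: "mult_upto p 1 F" and iY: "mult_upto p 1 Y" and ic: "mult_upto p 1 c"
    and iA: "mult_upto p 1 (1 - 16 * fps_X)"
    by (auto simp: F_def Y_def c_def intro!: mult_upto_diff mult_upto_mult_left)
  have iP: "mult_upto p 1 P"
    unfolding P_def by (rule mult_upto_1)
  have iV: "mult_upto p 1 V"
    unfolding V_def by (intro mult_upto_mult_left mult_upto_diff mult_upto_XD iF iY iA)
  have dp: "mult_upto p (int p) d"
    unfolding d_def Y_def c_def F_def by (rule deform_fps_cong [OF assms(1,2)])
  have i\<Delta>: "mult_upto p 1 \<Delta>"
    unfolding \<Delta>_def
    by (intro mult_upto_diff mult_upto_mult_left mult_upto_power iV iP ic iA iF mult_upto_1)
  have odeF: "(1 - 16 * fps_X) * XD (XD F) = 16 * fps_X * XD F + 4 * fps_X * F"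
    unfolding F_def by (rule binom_sq_fps_ode)
  have odeY: "4 * ((1 - 16 * fps_X) * XD (XD Y)) = 64 * fps_X * XD Y + 16 * fps_X * Y
      + 4 * P * ((1 - 16 * fps_X) * XD Y) - P * (32 * fps_X * Y) + P ^ 2 * R"
    using deform_fps_ode [OF assms(2)] by (simp add: Y_def P_def R_def c_def)
  have XDA: "XD (1 - 16 * fps_X) = - 16 * fps_X" by (simp add: XD_diff XD_mult)
  have c0: "XD c = 0" and P0: "XD P = 0" unfolding c_def P_def by (rule XD_of_int)+
  have XDV0: "XD V = - 16 * fps_X * (F * XD Y - Y * XD F) + F * ((1 - 16 * fps_X) * XD (XD Y))
      - Y * ((1 - 16 * fps_X) * XD (XD F))"
    unfolding V_def XD_mult XD_diff [of "_ * _"] XDA by (simp add: algebra_simps)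
  have "4 * XD V = - 64 * fps_X * (F * XD Y - Y * XD F) + F * (4 * ((1 - 16 * fps_X) * XD (XD Y)))
      - 4 * (Y * ((1 - 16 * fps_X) * XD (XD F)))"
    unfolding XDV0 by (simp add: algebra_simps)
  also have "\<dots> = F * (4 * P * ((1 - 16 * fps_X) * XD Y) - P * (32 * fps_X * Y) + P ^ 2 * R)"
    unfolding odeF odeY by (simp add: algebra_simps)
  finally have XDV: "4 * XD V = F * (4 * P * ((1 - 16 * fps_X) * XD Y) - P * (32 * fps_X * Y) + P ^ 2 * R)" .
  have XDd: "XD d = XD Y - c * XD F"
    by (simp add: d_def XD_diff XD_mult c0)
  have "XD \<Delta> = 4 * XD V - P * (2 * c * (- 16 * fps_X * F ^ 2 + (1 - 16 * fps_X) * (2 * F * XD F)))"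
    unfolding \<Delta>_def by (simp only: XD_diff [of "4 * V"] XD_mult XDA XD_square c0 P0 XD_numeral) simp
  also have "\<dots> = P * (4 * (1 - 16 * fps_X) * F * XD d - 32 * fps_X * F * d) + P ^ 2 * (F * R)"
    unfolding XDV XDd unfolding d_def by (simp add: power2_eq_square algebra_simps)
  finally have XD\<Delta>: "XD \<Delta> = P * (4 * (1 - 16 * fps_X) * F * XD d - 32 * fps_X * F * d) + P ^ 2 * (F * R)" .
  have "mult_upto p (int p * int p) (P * (4 * (1 - 16 * fps_X) * F * XD d - 32 * fps_X * F * d))"
    unfolding P_def
    by (intro mult_upto_scale mult_upto_diff mult_upto_mult_left mult_upto_XD dp iF mult_upto_1)
  moreover have "mult_upto p (int p ^ 2) (P ^ 2 * (F * R))"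
  proof -
    have "mult_upto p (int p ^ 2 * 1) (of_int (int p ^ 2) * (F * R))"
      unfolding R_def
      by (intro mult_upto_scale mult_upto_add mult_upto_diff mult_upto_mult_left iF iY ic mult_upto_1)
    then show ?thesis by (simp add: P_def)
  qed
  ultimately have "mult_upto p (int p ^ 2) (XD \<Delta>)"
    unfolding XD\<Delta> by (intro mult_upto_add) (simp_all add: power2_eq_square)
  then have "mult_upto p (int p ^ 2) (\<Delta> - fps_const (\<Delta> $ 0))"
    by (rule mult_upto_integrate [OF assms(1) i\<Delta>])
  \<comment> \<open>V has no constant term, so integration contributes the \<open>- 1\<close> of the
    claim.\<close>
  moreover have "fps_const (\<Delta> $ 0) = - (P * (2 * c))"
  proof -
    have "V $ 0 = 0" by (simp add: V_def)
    then have "\<Delta> $ 0 = of_int (- (int p * (2 * deform_coeff h 0)))"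
      by (simp add: \<Delta>_def F_def P_def c_def fps_power_zeroth)
    then have "fps_const (\<Delta> $ 0) = of_int (- (int p * (2 * deform_coeff h 0)))"
      by (simp only: fps_of_int)
    then show ?thesis
      by (simp add: P_def c_def)
  qed
  ultimately show ?thesis
    unfolding \<Delta>_def V_def P_def by (simp add: algebra_simps)
qed

text \<open>With \<open>K = theta4 ^ 4\<close>, \<open>wronskian_cong\<close> at t gives
  \<open>4 * XD W\<close> as \<open>2 p c (K - 1)\<close> modulo \<open>p ^ 2\<close>, while
  \<open>(q / t)^p\<close> has logarithmic derivative \<open>p (1 - K)\<close>. As W is c modulo p,
  the product has derivative 0 modulo \<open>p ^ 2\<close>. Squaring W avoids the half-integral
  exponent \<open>p/2\<close>.\<close>

lemma fps_quotient_square_cong: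
  assumes "prime p" "p = 2 * h + 1"
  defines "c \<equiv> of_int (deform_coeff h 0)"
    and "W \<equiv> (deform_fps h oo hauptmodul) * inverse (theta3 ^ 2)"
  shows "mult_upto p (int p ^ 2) (2 * (W ^ 2 * hauptmodul_inv ^ p - c ^ 2))"
proof -
  define t where "t = hauptmodul"
  define v where "v = hauptmodul_inv"
  define a where "a = theta3 ^ 2"
  define i where "i = inverse a"
  define K where "K = theta4 ^ 4"
  define P where "P = (of_int (int p) :: rat fps)"
  define y where "y = deform_fps h oo t"
  define Y1 where "Y1 = XD (deform_fps h) oo t"
  define F1 where "F1 = XD binom_sq_fps oo t"
  have W: "W = y * i" by (simp add: W_def y_def i_def t_def a_def)
  have t0: "t $ 0 = 0" by (simp add: t_def)
  have a0: "a $ 0 = 1" by (simp add: a_def fps_power_zeroth)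
  have ai: "a * i = 1" unfolding i_def using a0 by (intro inverse_mult_eq_1') simp
  have Ka: "(1 - 16 * t) * a ^ 2 = K"
    using one_minus_hauptmodul by (simp add: t_def a_def K_def flip: power_mult)
  have Fa: "binom_sq_fps oo t = a" unfolding t_def a_def by (rule binom_sq_fps_hauptmodul)
  have XDt: "XD t = K * t" unfolding t_def K_def by (rule XD_hauptmodul')
  have XDy: "XD y = K * Y1" unfolding y_def Y1_def by (rule XD_compose [OF t0 XDt])
  have XDa: "XD a = K * F1" unfolding Fa [symmetric] F1_def by (rule XD_compose [OF t0 XDt])
  have XDi: "XD i = - (K * F1 * i ^ 2)"
    unfolding i_def using XD_inverse [of a] a0 by (simp add: XDa)
  have XDv: "XD (v ^ p) = P * v ^ p * (1 - K)"
  proof -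
    have "p \<noteq> 0" using assms(2) by simp
    then have "v ^ p = v ^ (p - 1) * v" by (simp add: power_eq_if)
    then show ?thesis
      unfolding XD_power v_def XD_hauptmodul_inv by (simp add: K_def P_def mult_ac)
  qed
  have int: "mult_upto p 1 i" "mult_upto p 1 y" "mult_upto p 1 v" "mult_upto p 1 K" "mult_upto p 1 c"
    "mult_upto p 1 t" "mult_upto p 1 a"
  proof -
    show "mult_upto p 1 a" unfolding a_def by (intro mult_upto_power) simp
    then show "mult_upto p 1 i" unfolding i_def using a0 by (intro mult_upto_inverse)
    show "mult_upto p 1 y" unfolding y_def t_def by (intro mult_upto_compose) auto
    show "mult_upto p 1 K" unfolding K_def by (intro mult_upto_power) simp
  qed (auto simp: v_def c_def t_def)
  have iW: "mult_upto p 1 W" unfolding W by (intro mult_upto_mult_left int)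
  have Wc: "mult_upto p (int p) (W - c)"
  proof -
    have "mult_upto p (int p) ((deform_fps h - c * binom_sq_fps) oo t)"
      unfolding c_def by (intro mult_upto_compose deform_fps_cong assms int)
    also have "(deform_fps h - c * binom_sq_fps) oo t = y - c * a"
    proof -
      have "c oo t = c" unfolding c_def by (simp flip: fps_of_int)
      then show ?thesis
        using t0 by (simp add: fps_compose_sub_distrib fps_compose_mult_distrib Fa y_def)
    qed
    finally have "mult_upto p (int p) (i * (y - c * a))" by (intro mult_upto_mult_left int)
    moreover have "i * (y - c * a) = W - c"
      unfolding W using ai by (simp add: algebra_simps)
    ultimately show ?thesis by simp
  qed
  \<comment> \<open>Division by \<open>F(t)^2 = a ^ 2\<close> uses up the factor
    \<open>K = (1 - 16 * t) * a ^ 2\<close> of the chain rule.\<close>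
  have XDW: "XD W = (1 - 16 * t) * (a * Y1 - y * F1)"
  proof -
    have "XD W = K * Y1 * i - y * (K * F1 * i ^ 2)"
      unfolding W XD_mult XDy XDi by simp
    also have "\<dots> = (1 - 16 * t) * (Y1 * a * (a * i) - y * F1 * (a * i) ^ 2)"
      unfolding Ka [symmetric] by (simp add: power2_eq_square algebra_simps)
    finally show ?thesis unfolding ai by (simp add: mult_ac)
  qed
  have wr: "mult_upto p (int p ^ 2) (4 * XD W - P * (2 * c * (K - 1)))"
  proof -
    have "mult_upto p (int p ^ 2) ((4 * ((1 - 16 * fps_X) * (binom_sq_fps * XD (deform_fps h)
        - deform_fps h * XD binom_sq_fps))
        - of_int (int p) * (2 * c * ((1 - 16 * fps_X) * binom_sq_fps ^ 2 - 1))) oo t)"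
      unfolding c_def by (intro mult_upto_compose wronskian_cong assms int)
    also have "\<dots> = 4 * ((1 - 16 * t) * (a * Y1 - y * F1)) - P * (2 * c * ((1 - 16 * t) * a ^ 2 - 1))"
    proof -
      have "of_int m oo t = (of_int m :: rat fps)" for m by (simp flip: fps_of_int)
      then show ?thesis
        using t0 unfolding c_def P_def
        by (simp add: fps_compose_sub_distrib fps_compose_mult_distrib fps_compose_power [symmetric]
            Fa y_def Y1_def F1_def del: of_int_of_nat_eq)
    qed
    finally show ?thesis unfolding XDW Ka .
  qed
  \<comment> \<open>The factor 2 produces \<open>4 * XD W\<close>, the quantity controlled by
    \<open>wr\<close>.\<close>
  define Z where "Z = 2 * (W ^ 2 * v ^ p)"
  have "XD Z = W * v ^ p * (4 * XD W + P * (2 * W * (1 - K)))"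
    unfolding Z_def XD_mult XD_square XDv XD_numeral by (simp add: power2_eq_square algebra_simps)
  also have "\<dots> = W * v ^ p * ((4 * XD W - P * (2 * c * (K - 1))) + P * (2 * (1 - K) * (W - c)))"
    by (simp add: algebra_simps)
  finally have XDZ: "XD Z = W * v ^ p * ((4 * XD W - P * (2 * c * (K - 1))) + P * (2 * (1 - K) * (W - c)))" .
  have "mult_upto p (int p * int p) (P * (2 * (1 - K) * (W - c)))"
    unfolding P_def by (intro mult_upto_scale mult_upto_mult_left mult_upto_diff Wc int mult_upto_1)
  then have "mult_upto p (int p ^ 2) (P * (2 * (1 - K) * (W - c)))"
    by (simp add: power2_eq_square)
  then have "mult_upto p (int p ^ 2) (XD Z)"
    unfolding XDZ
    by (rule mult_upto_mult_left [OF mult_upto_mult_left [OF iW mult_upto_power [OF int(3)]]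
          mult_upto_add [OF wr]])
  moreover have "mult_upto p 1 Z"
    unfolding Z_def by (intro mult_upto_mult_left mult_upto_power iW int mult_upto_1)
  ultimately have "mult_upto p (int p ^ 2) (Z - fps_const (Z $ 0))"
    by (intro mult_upto_integrate assms)
  moreover have "fps_const (Z $ 0) = 2 * c ^ 2"
  proof -
    have "W $ 0 = of_int (deform_coeff h 0)"
      using a0 by (simp add: W y_def i_def deform_fps_def)
    then have "Z $ 0 = of_int (2 * deform_coeff h 0 ^ 2)"
      by (simp add: Z_def fps_power_zeroth v_def)
    then have "fps_const (Z $ 0) = of_int (2 * deform_coeff h 0 ^ 2)"
      by (simp only: fps_of_int)
    then show ?thesis by (simp add: c_def)
  qed
  ultimately show ?thesis
    unfolding Z_def v_def by (simp add: algebra_simps)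
qed

text \<open>Multiplication by \<open>eta_prod = t' F(t)^4\<close> turns \<open>W^2\<close> into
  \<open>F(t)^2 Y(t)^2 t'\<close>. With the factor \<open>(q / t)^p\<close>, the coefficient at
  \<open>p - 1\<close> is the residue of \<open>F^2 Y^2 dt / t^p\<close>, evaluated by
  \<open>lagrange_residue\<close>.\<close>

lemma eta_prod_nth_cong:
  assumes "prime p" "p = 2 * h + 1"
  shows "\<exists>z. 2 * (of_int (deform_coeff h 0) ^ 2 * eta_prod $ (p - 1)
    - (binom_sq_fps ^ 2 * deform_fps h ^ 2) $ (p - 1)) = of_int (int p ^ 2 * z)"
proof -
  define c where "c = (of_int (deform_coeff h 0) :: rat fps)"
  define a where "a = theta3 ^ 2"
  define y where "y = deform_fps h oo hauptmodul"
  define W where "W = y * inverse a"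
  define t' where "t' = fps_deriv hauptmodul"
  define H where "H = binom_sq_fps ^ 2 * deform_fps h ^ 2"
  have p: "p = Suc (p - 1)" using assms(2) by simp
  have a0: "a $ 0 = 1" by (simp add: a_def fps_power_zeroth)
  have aW: "a * W = y" unfolding W_def using inverse_mult_eq_1' [of a] a0 by (simp add: mult.left_commute)
  have Ha: "H oo hauptmodul = (a ^ 2 * W) * (a ^ 2 * W)"
  proof -
    have "H oo hauptmodul = a ^ 2 * y ^ 2"
      by (simp add: H_def fps_compose_mult_distrib fps_compose_power [symmetric] binom_sq_fps_hauptmodul a_def y_def)
    then show ?thesis unfolding aW [symmetric] by (simp add: power2_eq_square mult_ac)
  qed
  have e: "eta_prod = t' * a ^ 4"
    unfolding t'_def a_def eta_prod_eq by (simp flip: power_mult)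
  have "mult_upto p (int p ^ 2) (- (t' * a ^ 4 * (2 * (W ^ 2 * hauptmodul_inv ^ p - c ^ 2))))"
  proof (rule mult_upto_uminus, rule mult_upto_mult_left)
    show "mult_upto p (int p ^ 2) (2 * (W ^ 2 * hauptmodul_inv ^ p - c ^ 2))"
      using fps_quotient_square_cong [OF assms] unfolding W_def y_def a_def c_def .
    have "mult_upto p 1 t'" unfolding t'_def by (intro mult_upto_deriv) simp
    moreover have "mult_upto p 1 (a ^ 4)" unfolding a_def by (intro mult_upto_power) simp
    ultimately show "mult_upto p 1 (t' * a ^ 4)" by (rule mult_upto_mult_left)
  qed
  also have "- (t' * a ^ 4 * (2 * (W ^ 2 * hauptmodul_inv ^ p - c ^ 2)))
      = 2 * (c ^ 2 * eta_prod - (H oo hauptmodul) * (t' * hauptmodul_inv ^ p))"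
    unfolding Ha e by (simp add: algebra_simps power2_eq_square power4_eq_xxxx)
  finally have "mult_upto p (int p ^ 2)
      (2 * (c ^ 2 * eta_prod - (H oo hauptmodul) * (t' * hauptmodul_inv ^ p)))" .
  moreover have "p - 1 < p" using p by simp
  ultimately obtain z where
    "(2 * (c ^ 2 * eta_prod - (H oo hauptmodul) * (t' * hauptmodul_inv ^ p))) $ (p - 1) = of_int (int p ^ 2 * z)"
    unfolding mult_upto_def by meson
  moreover have "((H oo hauptmodul) * (t' * hauptmodul_inv ^ p)) $ (p - 1) = H $ (p - 1)"
    using lagrange_residue [OF hauptmodul_mult_inv, of H "p - 1"] p unfolding t'_def by simp
  moreover have "(c ^ 2 * eta_prod) $ (p - 1) = of_int (deform_coeff h 0) ^ 2 * eta_prod $ (p - 1)"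
    using of_int_mult_nth [of "deform_coeff h 0 ^ 2" eta_prod "p - 1"] by (simp add: c_def)
  moreover have "(2 * f) $ n = 2 * f $ n" for f :: "rat fps" and n
    by (simp add: numeral_fps_const)
  ultimately show ?thesis unfolding H_def by auto
qed

section \<open>The congruence\<close>

definition fps_of_int_poly :: "int poly \<Rightarrow> rat fps" where
  "fps_of_int_poly q = Abs_fps (\<lambda>n. of_int (coeff q n))"

lemma fps_of_int_poly_1: "fps_of_int_poly 1 = 1"
  by (simp add: fps_of_int_poly_def fps_eq_iff)

lemma fps_of_int_poly_mult: "fps_of_int_poly (q * r) = fps_of_int_poly q * fps_of_int_poly r"
  by (simp add: fps_of_int_poly_def fps_eq_iff coeff_mult fps_mult_nth atLeast0AtMost)

lemma fps_of_int_poly_power: "fps_of_int_poly (q ^ n) = fps_of_int_poly q ^ n"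
  by (induction n) (simp_all add: fps_of_int_poly_1 fps_of_int_poly_mult)

lemma fps_of_int_poly_prod: "fps_of_int_poly (prod f A) = (\<Prod>x\<in>A. fps_of_int_poly (f x))"
  by (induction A rule: infinite_finite_induct) (simp_all add: fps_of_int_poly_1 fps_of_int_poly_mult)

lemma fps_of_int_poly_one_minus_monom: "fps_of_int_poly (1 - monom 1 k) = 1 - fps_X ^ k"
  by (auto simp: fps_of_int_poly_def fps_eq_iff fps_X_power_nth)

lemma dilate_euler_poly: "dilate (euler_poly n) = (\<Prod>j=1..n. 1 - fps_X ^ (2 * j))"
  by (induction n) (simp_all add: euler_poly_Suc del: power_Suc flip: power_mult)

lemma eta12_coeff_eq:
  assumes "n > 0"
  shows "rat_of_int (eta12_coeff n) = eta_prod $ (n - 1)"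
proof -
  have "rat_of_int (eta12_coeff n) = (dilate (euler_poly n) ^ 12) $ (n - 1)"
    using assms
    by (simp add: eta12_coeff_def dilate_euler_poly prod_power_distrib flip: fps_of_int_poly_one_minus_monom
        fps_of_int_poly_power fps_of_int_poly_prod) (simp add: fps_of_int_poly_def)
  moreover have "fps_X ^ Suc n dvd dilate euler ^ 12 - dilate (euler_poly n) ^ 12"
  proof -
    have "fps_X ^ Suc n dvd dilate euler - dilate (euler_poly n)"
      using dilate_X_power_dvd [OF euler_cong] by simp
    also have "\<dots> dvd dilate euler ^ 12 - dilate (euler_poly n) ^ 12"
      by (simp add: power_diff_sumr2)
    finally show ?thesis .
  qed
  ultimately show ?thesis
    by (auto simp: eta_prod_def fps_X_power_dvd_iff simp del: power_Suc)
qed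

lemma fps_prod4_nth:
  fixes f g :: "nat \<Rightarrow> int" and h :: nat
  defines "A \<equiv> Abs_fps (\<lambda>k. if k \<le> h then rat_of_int (f k) else 0)"
    and "B \<equiv> Abs_fps (\<lambda>k. if k \<le> h then rat_of_int (g k) else 0)"
  shows "(A ^ 2 * B ^ 2) $ n = of_int (\<Sum>k1\<le>h. \<Sum>k2\<le>h. \<Sum>k3\<le>h. \<Sum>k4\<le>h.
    if k1 + k2 + k3 + k4 = n then f k1 * f k2 * g k3 * g k4 else 0)"
proof -
  have A: "A = (\<Sum>k\<le>h. fps_const (of_int (f k)) * fps_X ^ k)"
    and B: "B = (\<Sum>k\<le>h. fps_const (of_int (g k)) * fps_X ^ k)"
    unfolding A_def B_def
    by (auto simp: fps_eq_iff fps_sum_nth fps_X_power_nth if_distrib cong: if_cong)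
  have "A ^ 2 * B ^ 2 = A * (A * (B * B))" by (simp add: power2_eq_square mult_ac)
  also have "\<dots> = (\<Sum>k1\<le>h. \<Sum>k2\<le>h. \<Sum>k3\<le>h. \<Sum>k4\<le>h.
      fps_const (of_int (f k1 * f k2 * g k3 * g k4)) * fps_X ^ (k1 + k2 + k3 + k4))"
    unfolding A B
    by (simp only: sum_distrib_right, simp only: sum_distrib_left)
      (intro sum.cong refl, simp add: power_add mult_ac flip: fps_const_mult)
  finally show ?thesis
    by (auto simp: fps_sum_nth fps_X_power_nth intro!: sum.cong)
qed

lemma sum_atMost_rev: "(\<Sum>k\<le>h. g (h - k)) = (\<Sum>k\<le>h. g k)" for g :: "nat \<Rightarrow> 'a::comm_monoid_add"
  by (rule sum.reindex_bij_witness [of _ "\<lambda>k. h - k" "\<lambda>k. h - k"]) auto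

lemma sum2_atMost_rev:
  fixes g :: "nat \<Rightarrow> nat \<Rightarrow> 'a::comm_monoid_add"
  shows "(\<Sum>j\<le>h. \<Sum>k\<le>h. g j k) = (\<Sum>j\<le>h. \<Sum>k\<le>h. g (h - j) (h - k))"
  by (simp add: sum_atMost_rev [of "g _"] sum_atMost_rev [of "\<lambda>j. \<Sum>k\<le>h. g j k"])

theorem theorem5p1:
  fixes p :: nat
  assumes "prime p" and "odd p"
  shows "[eta12_coeff p =
           (\<Sum>k1\<le>(p-1) div 2. \<Sum>k2\<le>(p-1) div 2. \<Sum>k3\<le>(p-1) div 2. \<Sum>k4\<le>(p-1) div 2.
              if k1 + k2 = k3 + k4 then
                binom_term ((p-1) div 2) k1 * binom_term ((p-1) div 2) k2 *
                binom_term ((p-1) div 2) k3 * binom_term ((p-1) div 2) k4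
              else 0)] (mod (int p)^2)"
proof -
  define h where "h = (p - 1) div 2"
  have p: "p = 2 * h + 1" using assms(2) by (auto simp: h_def elim!: oddE)
  define M where "M = int p ^ 2"
  define F where "F = (\<lambda>k. int (2 * k choose k) ^ 2)"
  define a where "a = binom_term h"
  define S where "S = (\<Sum>k1\<le>h. \<Sum>k2\<le>h. \<Sum>k3\<le>h. \<Sum>k4\<le>h.
    if k1 + k2 = k3 + k4 then a k1 * a k2 * a k3 * a k4 else 0)"
  define A where "A = Abs_fps (\<lambda>k. if k \<le> h then rat_of_int (F k) else 0)"
  define T where "T = (\<Sum>k1\<le>h. \<Sum>k2\<le>h. \<Sum>k3\<le>h. \<Sum>k4\<le>h.
    if k1 + k2 + k3 + k4 = 2 * h then F k1 * F k2 * deform_coeff h k3 * deform_coeff h k4 else 0)"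
  define B where "B = int (2 * h choose h)"
  have Fa: "[F k = (-1) ^ k * (16 ^ k * a k)] (mod M)" if "k < p" for k
  proof -
    have "[(-1) ^ k * (16 ^ k * a k) = (-1) ^ k * ((-1) ^ k * F k)] (mod M)"
      unfolding F_def a_def M_def by (intro cong_scalar_left binom_term_cong assms p that)
    moreover have "(-1) ^ k * ((-1) ^ k * F k) = F k" by (cases "even k") auto
    ultimately show ?thesis by (simp add: cong_sym_eq)
  qed
  have AB: "(A ^ 2 * deform_fps h ^ 2) $ (2 * h) = of_int T"
  proof -
    have "deform_fps h = Abs_fps (\<lambda>k. if k \<le> h then rat_of_int (deform_coeff h k) else 0)"
      by (auto simp: deform_fps_def fps_eq_iff deform_coeff_def)
    then show ?thesis unfolding A_def T_def by (simp only: fps_prod4_nth)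
  qed
  \<comment> \<open>Between h and p, \<open>a n\<close> is 0, so \<open>F n\<close> is divisible by
    \<open>p ^ 2\<close> and the series may be cut off at h.\<close>
  have FA: "mult_upto p M (binom_sq_fps - A)"
  proof (rule mult_uptoI)
    fix n assume "n < p"
    show "\<exists>z. (binom_sq_fps - A) $ n = of_int (M * z)"
    proof (cases "n \<le> h")
      case False
      then have "a n = 0" by (simp add: a_def binom_term_def)
      with Fa [OF \<open>n < p\<close>] have "M dvd F n" by (simp add: cong_0_iff)
      then obtain z where "F n = M * z" by (elim dvdE)
      moreover have "(binom_sq_fps - A) $ n = of_int (F n)"
        using False by (simp add: A_def binom_sq_fps_def F_def)
      ultimately show ?thesis by metis
    qed (auto simp: A_def binom_sq_fps_def F_def intro!: exI [of _ 0])
  qed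
  have "mult_upto p M ((binom_sq_fps + A) * deform_fps h ^ 2 * (binom_sq_fps - A))"
  proof (rule mult_upto_mult_left [OF _ FA])
    have "mult_upto p 1 A" by (rule mult_uptoI) (auto simp: A_def intro: exI [of _ 0])
    then show "mult_upto p 1 ((binom_sq_fps + A) * deform_fps h ^ 2)"
      by (intro mult_upto_mult_left mult_upto_add mult_upto_power) auto
  qed
  moreover have "(binom_sq_fps + A) * deform_fps h ^ 2 * (binom_sq_fps - A)
      = binom_sq_fps ^ 2 * deform_fps h ^ 2 - A ^ 2 * deform_fps h ^ 2"
    by (simp add: power2_eq_square algebra_simps)
  ultimately have "mult_upto p M (binom_sq_fps ^ 2 * deform_fps h ^ 2 - A ^ 2 * deform_fps h ^ 2)"
    by simp
  then obtain z where z: "(binom_sq_fps ^ 2 * deform_fps h ^ 2 - A ^ 2 * deform_fps h ^ 2) $ (2 * h) = of_int (M * z)"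
    unfolding mult_upto_def using p by (meson less_add_one)
  have p1: "p - 1 = 2 * h" using p by simp
  have d0: "deform_coeff h 0 ^ 2 = B ^ 4"
    by (simp add: deform_coeff_def B_def flip: power_mult)
  obtain w where w: "2 * (of_int (deform_coeff h 0) ^ 2 * eta_prod $ (2 * h)
      - (binom_sq_fps ^ 2 * deform_fps h ^ 2) $ (2 * h)) = of_int (M * w)"
    using eta_prod_nth_cong [OF assms(1) p] unfolding p1 M_def by blast
  have e: "eta_prod $ (2 * h) = of_int (eta12_coeff p)"
    using eta12_coeff_eq [of p] p by simp
  have "rat_of_int (2 * (B ^ 4 * eta12_coeff p - T)) = of_int (M * (w + 2 * z))"
    using w z AB unfolding e d0 [symmetric] by (simp add: algebra_simps)
  then have "2 * (B ^ 4 * eta12_coeff p - T) = M * (w + 2 * z)" by (simp only: of_int_eq_iff)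
  then have "[2 * (B ^ 4 * eta12_coeff p) = 2 * T] (mod M)"
    by (simp add: cong_iff_dvd_diff algebra_simps)
  moreover have "\<not> int p dvd 2"
    using prime_not_dvd_power2 [OF assms, of 1] by simp
  ultimately have BT: "[B ^ 4 * eta12_coeff p = T] (mod M)"
    unfolding M_def using prime_cong_cancel [OF assms(1)] by blast
  have TS: "[T = 256 ^ (2 * h) * S] (mod M)"
  proof -
    \<comment> \<open>Reversing k3 and k4 turns total 2h into the balanced condition and the
      deformed coefficients into powers of 256 times \<open>F\<close>.\<close>
    have T: "T = (\<Sum>k1\<le>h. \<Sum>k2\<le>h. \<Sum>k3\<le>h. \<Sum>k4\<le>h.
        if k1 + k2 + (h - k3) + (h - k4) = 2 * h
        then F k1 * F k2 * deform_coeff h (h - k3) * deform_coeff h (h - k4) else 0)"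
      unfolding T_def by (rule sum.cong [OF refl], rule sum.cong [OF refl], rule sum2_atMost_rev)
    have S: "256 ^ (2 * h) * S = (\<Sum>k1\<le>h. \<Sum>k2\<le>h. \<Sum>k3\<le>h. \<Sum>k4\<le>h.
        256 ^ (2 * h) * (if k1 + k2 = k3 + k4 then a k1 * a k2 * a k3 * a k4 else 0))"
      by (simp only: S_def sum_distrib_left)
    show ?thesis unfolding T S
    proof (intro cong_sum)
      fix k1 k2 k3 k4
      assume k: "k1 \<in> {..h}" "k2 \<in> {..h}" "k3 \<in> {..h}" "k4 \<in> {..h}"
      then have iff: "k1 + k2 + (h - k3) + (h - k4) = 2 * h \<longleftrightarrow> k1 + k2 = k3 + k4" by auto
      \<comment> \<open>The signs cancel since \<open>k1 + k2 = k3 + k4\<close>, and for the same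
        reason the powers of 16 combine to \<open>256 ^ (k3 + k4)\<close>, completing the exponent
        2h.\<close>
      have "[F k1 * F k2 * deform_coeff h (h - k3) * deform_coeff h (h - k4)
          = 256 ^ (2 * h) * (a k1 * a k2 * a k3 * a k4)] (mod M)" if eq: "k1 + k2 = k3 + k4"
      proof -
        have "F k1 * F k2 * deform_coeff h (h - k3) * deform_coeff h (h - k4)
            = 256 ^ (h - k3) * 256 ^ (h - k4) * (F k1 * F k2 * (F k3 * F k4))"
          using k by (simp add: deform_coeff_def F_def)
        also have "[\<dots> = 256 ^ (h - k3) * 256 ^ (h - k4) *
            ((-1) ^ k1 * (16 ^ k1 * a k1) * ((-1) ^ k2 * (16 ^ k2 * a k2))
              * ((-1) ^ k3 * (16 ^ k3 * a k3) * ((-1) ^ k4 * (16 ^ k4 * a k4))))] (mod M)"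
          using k p by (intro cong_scalar_left cong_mult Fa) auto
        also have "256 ^ (h - k3) * 256 ^ (h - k4) *
            ((-1) ^ k1 * (16 ^ k1 * a k1) * ((-1) ^ k2 * (16 ^ k2 * a k2))
              * ((-1) ^ k3 * (16 ^ k3 * a k3) * ((-1) ^ k4 * (16 ^ k4 * a k4))))
            = ((-1) ^ (k1 + k2) * (-1) ^ (k3 + k4)) * (256 ^ (h - k3) * 256 ^ (h - k4) *
              (16 ^ (k1 + k2) * 16 ^ (k3 + k4))) * (a k1 * a k2 * a k3 * a k4)"
          by (simp add: power_add mult_ac)
        also have "(-1 :: int) ^ (k1 + k2) * (-1) ^ (k3 + k4) = 1"
          unfolding eq by (simp flip: power_mult_distrib)
        also have "(16 :: int) ^ (k1 + k2) * 16 ^ (k3 + k4) = 256 ^ (k3 + k4)"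
          unfolding eq by (simp flip: power_mult_distrib)
        also have "(256 :: int) ^ (h - k3) * 256 ^ (h - k4) * 256 ^ (k3 + k4) = 256 ^ (2 * h)"
        proof -
          have "2 * h = (h - k3) + (h - k4) + (k3 + k4)" using k by auto
          then show ?thesis by (metis power_add)
        qed
        finally show ?thesis by simp
      qed
      then show "[if k1 + k2 + (h - k3) + (h - k4) = 2 * h
          then F k1 * F k2 * deform_coeff h (h - k3) * deform_coeff h (h - k4) else 0
          = 256 ^ (2 * h) * (if k1 + k2 = k3 + k4 then a k1 * a k2 * a k3 * a k4 else 0)] (mod M)"
        unfolding iff by simp
    qed
  qed
  \<comment> \<open>The normalisation \<open>deform_coeff h 0 ^ 2 = B ^ 4\<close> is, modulo
    \<open>p ^ 2\<close>, the same power of 256 as in \<open>TS\<close>, so the two cancel.\<close>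
  have B4: "[B ^ 4 = 256 ^ (2 * h)] (mod M)"
  proof -
    have "[B ^ 4 = ((-1) ^ h * 16 ^ h) ^ 4] (mod M)"
      unfolding B_def M_def by (intro cong_pow central_binomial_cong assms p)
    also have "((-1) ^ h * 16 ^ h :: int) ^ 4 = ((-1) ^ h) ^ 4 * ((16 ^ 2) ^ (2 * h))"
      unfolding power_mult_distrib power_mult [symmetric] by (simp add: mult.commute)
    also have "((-1 :: int) ^ h) ^ 4 = 1" by (cases "even h") auto
    finally show ?thesis by simp
  qed
  have "[256 ^ (2 * h) * eta12_coeff p = 256 ^ (2 * h) * S] (mod M)"
    by (rule cong_trans [OF cong_mult [OF cong_sym [OF B4] cong_refl] cong_trans [OF BT TS]])
  moreover have "\<not> int p dvd 256 ^ (2 * h)"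
    using prime_not_dvd_power2 [OF assms, of "8 * (2 * h)"] by (simp add: power_mult)
  ultimately have "[eta12_coeff p = S] (mod M)"
    unfolding M_def using prime_cong_cancel [OF assms(1)] by blast
  then show ?thesis unfolding S_def M_def a_def h_def .
qed

end
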